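(* Assume $n_{\mathrm{per}}\ne N$ (i.e. exclude the trivial case in which all the cyclic classes have only one element). Then the almost sure asymptotic synchronization of the system within each cyclic class holds, i.e. $Z_{n,l_2}-Z_{n,l_1}\to0$ almost surely for each pair $(l_1,l_2)$ of indices in $V$ with $l_1\sim_c l_2$, if and only if $\sum_n r_n=+\infty$.
   Context: Let $N\ge 2$, $V=\{1,\dots,N\}$, and let $W=[w_{l_1,l_2}]_{l_1,l_2\in V}$ be an irreducible real matrix with non-negative entries such that $W^\top\mathbf{1}=\mathbf{1}$, where $\mathbf{1}$ is the all-ones vector ($\mathbf{0}$ is the zero vector). Let $(r_n)_{n\ge0}$ be a deterministic sequence with $0<r_n<1$. Let $\mathbf{Z}_0=[Z_{0,1},\dots,Z_{0,N}]^\top$ be a random vector with values in $[0,1]^N$ such that $P(\mathbf{Z}_0=\mathbf{0})+P(\mathbf{Z}_0=\mathbf{1})<1$ and, for $n\ge 0$, let $\mathcal{F}_n=\sigma(Z_{0,l}:l\in V)\vee\sigma(X_{k,l}:1\le k\le n,\,l\in V)$. Given $\mathcal{F}_n$, the random variables $X_{n+1,l}$, $l\in V$, are $\{0,1\}$-valued and conditionally independent with $P(X_{n+1,l}=1\mid\mathcal{F}_n)=\sum_{l_1=1}^N w_{l_1,l}Z_{n,l_1}=[W^\top\mathbf{Z}_n]_l$, and $\mathbf{Z}_{n+1}=(1-r_n)\mathbf{Z}_n+r_n\mathbf{X}_{n+1}$, where $\mathbf{X}_{n}=[X_{n,1},\dots,X_{n,N}]^\top$, $\mathbf{Z}_{n}=[Z_{n,1},\dots,Z_{n,N}]^\top$.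 Let $n_{\mathrm{per}}\ge1$ be the period of the irreducible matrix $W^\top$ ($\gcd\{k\ge1:[(W^\top)^k]_{l,l}>0\}$, independent of $l$). The set $V$ is partitioned into $n_{\mathrm{per}}$ cyclic classes, numbered $0,\dots,n_{\mathrm{per}}-1$ (numbers modulo $n_{\mathrm{per}}$), such that $[W^\top]_{l_1,l_2}=0$ when $l_1$ is in class $h$ and $l_2$ is not in class $h+1$; they are the communicating classes of $(W^\top)^{n_{\mathrm{per}}}$. Write $l_1\sim_c l_2$ if $l_1,l_2$ are in the same cyclic class. *)

theory Defs
  imports "HOL-Probability.Probability"
begin

text \<open>
  On \<^typ>\<open>real ^ 'n ^ 'n\<close> the class operations \<open>*\<close> and \<open>^\<close> act componentwise, so powers with
  respect to the matrix product are iterated explicitly.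
\<close>

definition matpow :: "real ^ 'n ^ 'n \<Rightarrow> nat \<Rightarrow> real ^ 'n ^ 'n" where
  "matpow A k = (((**) A) ^^ k) (mat 1)"

text \<open>Intended for matrices with non-negative entries.\<close>

definition irreducible_matrix :: "real ^ 'n ^ 'n \<Rightarrow> bool" where
  "irreducible_matrix A \<longleftrightarrow> (\<forall>i j. \<exists>k\<ge>1. matpow A k $ i $ j > 0)"

definition index_period :: "real ^ 'n ^ 'n \<Rightarrow> 'n \<Rightarrow> nat" where
  "index_period A l = Gcd {k. k \<ge> 1 \<and> matpow A k $ l $ l > 0}"

text \<open>
  The common value of \<^const>\<open>index_period\<close>; it exists for irreducible non-negative matrices,
  see \<open>index_period_eq\<close> below.
\<close>

definition matrix_period :: "real ^ 'n ^ 'n \<Rightarrow> nat" where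
  "matrix_period A = (THE d. \<forall>l. index_period A l = d)"

definition communicate :: "real ^ 'n ^ 'n \<Rightarrow> 'n \<Rightarrow> 'n \<Rightarrow> bool" where
  "communicate A i j \<longleftrightarrow> (\<exists>k. matpow A k $ i $ j > 0) \<and> (\<exists>k. matpow A k $ j $ i > 0)"

text \<open>
  The cyclic classes are the communicating classes of the power of \<open>A\<close> to its period.  That they
  can be numbered so that \<open>A\<close> leads from each class only to the next one modulo the period is
  \<open>cyclic_classes_exist\<close> below.
\<close>

definition same_cyclic_class :: "real ^ 'n ^ 'n \<Rightarrow> 'n \<Rightarrow> 'n \<Rightarrow> bool" where
  "same_cyclic_class A = communicate (matpow A (matrix_period A))"

text \<open>
  The sigma-algebra generated by the components of the initial vector \<open>Z\<^sub>0\<close> and of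
  \<open>X\<^sub>1, \<dots>, X\<^sub>n\<close>; the value of \<open>X\<close> at time \<open>0\<close> plays no role.
\<close>

definition hist :: "'a measure \<Rightarrow> ('a \<Rightarrow> real ^ 'n) \<Rightarrow> (nat \<Rightarrow> 'a \<Rightarrow> real ^ 'n) \<Rightarrow> nat \<Rightarrow> 'a measure" where
  "hist M Z0 X n = sigma (space M)
     ({(\<lambda>\<omega>. Z0 \<omega> $ l) -` B \<inter> space M | l B. B \<in> sets borel} \<union>
      {(\<lambda>\<omega>. X k \<omega> $ l) -` B \<inter> space M | k l B. 1 \<le> k \<and> k \<le> n \<and> B \<in> sets borel})"

definition cond_indep_vars ::
    "'a measure \<Rightarrow> 'a measure \<Rightarrow> ('i \<Rightarrow> 'b measure) \<Rightarrow> ('i \<Rightarrow> 'a \<Rightarrow> 'b) \<Rightarrow> 'i set \<Rightarrow> bool" where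
  "cond_indep_vars M F M' X I \<longleftrightarrow>
     (\<forall>i\<in>I. X i \<in> measurable M (M' i)) \<and>
     (\<forall>J\<subseteq>I. finite J \<longrightarrow> J \<noteq> {} \<longrightarrow> (\<forall>B\<in>(\<Pi> i\<in>J. sets (M' i)).
        AE \<omega> in M. real_cond_exp M F (indicator {\<omega> \<in> space M. \<forall>i\<in>J. X i \<omega> \<in> B i}) \<omega> =
          (\<Prod>i\<in>J. real_cond_exp M F (indicator {\<omega> \<in> space M. X i \<omega> \<in> B i}) \<omega>)))"

lemma matpow_0: "matpow A 0 = mat 1"
  by (simp add: matpow_def)

lemma matpow_Suc: "matpow A (Suc k) = A ** matpow A k"
  by (simp add: matpow_def)

lemma matpow_1: "matpow A (Suc 0) = A"
  by (simp add: matpow_def)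

lemma matpow_add: "matpow A (a + b) = matpow A a ** matpow A b"
  by (induction a) (simp_all add: matpow_0 matpow_Suc matrix_mul_assoc)

lemma matpow_mult: "matpow A (a * b) = matpow (matpow A a) b"
  by (induction b) (simp_all add: matpow_0 matpow_Suc matpow_add)

lemma matpow_nonneg:
  assumes "\<forall>i j. 0 \<le> A $ i $ j"
  shows "0 \<le> matpow A k $ i $ j"
proof (induction k arbitrary: i j)
  case 0
  then show ?case by (simp add: matpow_0 mat_def)
next
  case (Suc k)
  then show ?case
    using assms by (auto simp: matpow_Suc matrix_matrix_mult_def intro!: sum_nonneg)
qed

lemma matpow_pos_add:
  assumes "\<forall>i j. 0 \<le> A $ i $ j" "matpow A a $ i $ l > 0" "matpow A b $ l $ j > 0"
  shows "matpow A (a + b) $ i $ j > 0"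
proof -
  have "0 < matpow A a $ i $ l * matpow A b $ l $ j"
    using assms by simp
  also have "\<dots> \<le> (\<Sum>m\<in>UNIV. matpow A a $ i $ m * matpow A b $ m $ j)"
    by (rule member_le_sum) (auto simp: matpow_nonneg[OF assms(1)])
  finally show ?thesis
    by (simp add: matpow_add matrix_matrix_mult_def)
qed

lemma index_period_dvd: "matpow A k $ l $ l > 0 \<Longrightarrow> index_period A l dvd k"
  by (cases "k = 0") (auto simp: index_period_def)

lemma index_period_eq:
  assumes "\<forall>i j. 0 \<le> A $ i $ j" "irreducible_matrix A"
  shows "index_period A l = index_period A l'"
proof -
  have "index_period A l dvd index_period A l'" for l l'
    unfolding index_period_def[of A l']
  proof (rule Gcd_greatest, clarify)
    fix k assume k: "matpow A k $ l' $ l' > 0"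
    obtain a b where ab: "matpow A a $ l $ l' > 0" "matpow A b $ l' $ l > 0"
      using assms(2) by (meson irreducible_matrix_def)
    have "index_period A l dvd a + b"
      by (rule index_period_dvd[OF matpow_pos_add[OF assms(1) ab]])
    moreover have "index_period A l dvd (a + k) + b"
      by (rule index_period_dvd[OF matpow_pos_add[OF assms(1) matpow_pos_add[OF assms(1) ab(1) k] ab(2)]])
    ultimately show "index_period A l dvd k"
      by (metis add.assoc add.commute dvd_add_right_iff)
  qed
  then show ?thesis by (simp add: dvd_antisym)
qed

lemma matrix_period_eq:
  assumes "\<forall>i j. 0 \<le> A $ i $ j" "irreducible_matrix A"
  shows "matrix_period A = index_period A l"
  unfolding matrix_period_def
  by (rule the_equality) (auto intro: index_period_eq[OF assms])

lemma matrix_period_pos: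
  assumes "\<forall>i j. 0 \<le> A $ i $ j" "irreducible_matrix A"
  shows "matrix_period A \<ge> 1"
proof -
  obtain l :: 'a and k where "k \<ge> 1" "matpow A k $ l $ l > 0"
    using assms(2) by (meson irreducible_matrix_def)
  then have "index_period A l \<noteq> 0"
    using index_period_dvd[of A k l] by auto
  then show ?thesis using matrix_period_eq[OF assms, of l] by simp
qed

lemma cyclic_classes_exist:
  fixes A :: "real ^ 'n ^ 'n"
  assumes nonneg: "\<forall>i j. 0 \<le> A $ i $ j" and irr: "irreducible_matrix A"
  shows "\<exists>c :: 'n \<Rightarrow> nat. range c = {..<matrix_period A} \<and>
     (\<forall>i j. c j \<noteq> (c i + 1) mod matrix_period A \<longrightarrow> A $ i $ j = 0) \<and>
     (\<forall>i j. c i = c j \<longleftrightarrow> same_cyclic_class A i j)"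
proof -
  define d where "d = matrix_period A"
  have d1: "d \<ge> 1" using matrix_period_pos[OF assms] by (simp add: d_def)
  have dvd: "d dvd k" if "matpow A k $ l $ l > 0" for k l
    using index_period_dvd[OF that] matrix_period_eq[OF assms] by (simp add: d_def)
  fix l0 :: 'n
  have reach: "\<exists>k. matpow A k $ i $ j > 0" for i j
    using irr by (meson irreducible_matrix_def)
  define c where "c j = (SOME k. matpow A k $ l0 $ j > 0) mod d" for j
  have c: "c j = k mod d" if k: "matpow A k $ l0 $ j > 0" for j k
  proof -
    define k' where "k' = (SOME k. matpow A k $ l0 $ j > 0)"
    have k': "matpow A k' $ l0 $ j > 0"
      unfolding k'_def by (rule someI, rule k)
    obtain m where m: "matpow A m $ j $ l0 > 0" using reach by blast
    have "d dvd k + m" "d dvd k' + m"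
      using dvd matpow_pos_add[OF nonneg] k k' m by blast+
    then have "int k' mod int d = int k mod int d"
      by (simp add: mod_eq_dvd_iff flip: int_dvd_int_iff)
         (metis add_diff_cancel_right dvd_diff)
    then have "k' mod d = k mod d" by (metis of_nat_eq_iff zmod_int)
    then show ?thesis by (simp add: c_def k'_def)
  qed
  have step: "c j = (c i + k) mod d" if "matpow A k $ i $ j > 0" for i j k
  proof -
    obtain m where m: "matpow A m $ l0 $ i > 0" using reach by blast
    from c[OF matpow_pos_add[OF nonneg m that]] c[OF m] show ?thesis
      by (simp add: mod_add_left_eq)
  qed
  have same1: "\<exists>q. matpow (matpow A d) q $ i $ j > 0" if "c i = c j" for i j
  proof -
    obtain m where m: "matpow A m $ i $ j > 0" using reach by blast
    have "(c i + m) mod d = c i mod d"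
      using step[OF m] that by (metis mod_mod_trivial)
    then have "d dvd (c i + m) - c i"
      by (simp add: mod_eq_dvd_iff_nat)
    then have "m = d * (m div d)" by simp
    then show ?thesis using m by (metis matpow_mult)
  qed
  have same2: "c i = c j" if "matpow (matpow A d) q $ i $ j > 0" for i j q
    using step[of "d * q" i j] that by (simp add: matpow_mult c_def)
  have "{..<d} \<subseteq> range c"
  proof
    fix k assume k: "k \<in> {..<d}"
    have "\<exists>j. matpow A k $ l0 $ j > 0" for k
    proof (induction k)
      case 0
      show ?case by (rule exI[of _ l0]) (simp add: matpow_0 mat_def)
    next
      case (Suc k)
      then obtain i where i: "matpow A k $ l0 $ i > 0" by blast
      obtain m where m: "m \<ge> 1" "matpow A m $ i $ l0 > 0"
        using irr by (meson irreducible_matrix_def)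
      have "\<exists>j. A $ i $ j > 0"
      proof (rule ccontr)
        assume "\<nexists>j. A $ i $ j > 0"
        then have "A $ i $ j = 0" for j using nonneg by (metis order_le_less)
        then have "matpow A m $ i $ l0 = 0"
          using m(1) by (cases m) (auto simp: matpow_Suc matrix_matrix_mult_def)
        then show False using m by simp
      qed
      then obtain j where "matpow A (Suc 0) $ i $ j > 0" by (auto simp: matpow_1)
      from matpow_pos_add[OF nonneg i this] show ?case by auto
    qed
    then obtain j where "matpow A k $ l0 $ j > 0" by blast
    from c[OF this] k have "k = c j" by simp
    then show "k \<in> range c" by simp
  qed
  moreover have "range c \<subseteq> {..<d}" using d1 by (auto simp: c_def)
  moreover have "A $ i $ j = 0" if "c j \<noteq> (c i + 1) mod d" for i j
    using step[of "Suc 0" i j] that nonneg by (force simp: matpow_1 order_le_less)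
  moreover have "c i = c j \<longleftrightarrow> same_cyclic_class A i j" for i j
    unfolding same_cyclic_class_def communicate_def d_def[symmetric]
    using same1[of i j] same1[of j i] same2[of _ i j] by auto
  ultimately show ?thesis unfolding d_def[symmetric] by (intro exI[of _ c]) blast
qed

end

(*
  Write P for the transpose of W. It is row stochastic and irreducible, with a positive stationary
  vector v.

  If sum r_n diverges: v . Z_n is a bounded martingale, so the noise variances are summable. The
  quadratic form q(z) = sum of v_i v_j (z_i - z_j)^2 over pairs i, j in a common cyclic class does
  not increase under P and is contracted by some power P^K, hence Q(z) = q(z) + q(P z) + ... +
  q(P^(K-1) z) satisfies Q((1 - r) z + r P z) <= (1 - kappa r) Q(z). So Q(Z_n) is a supermartingale
  up to a summable error, its expectation tends to 0, and a maximal inequality gives almost sure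
  convergence to 0.

  If sum r_n converges: at some time all components lie in the open unit interval with positive
  probability. From then on, every finite pattern of X has positive probability. Hence two
  components can be driven apart until the remaining total step size is too small to close the gap.
*)

theory Submission
  imports Defs
begin

section \<open>Irreducible stochastic matrices\<close>

text \<open>Nothing is assumed about the sum of the squared step sizes, so the noise cannot be
  summed by means of \<open>r\<close> alone; the Bernoulli variances have to help. The stationary
  average has no drift whatever the step sizes are, and it stays bounded, which forces the squared
  steps weighted with these variances to be summable. Since every stationary weight is positive, no
  coordinate escapes this control. For a periodic matrix the powers of P need not converge, and
  differences between classes may persist. The form therefore compares only indices of one class,
  and its contraction rests on the fact that two such indices have a common ancestor at some fixed
  distance K. Conditional laws are used only through integrals against bounded functions of the
  past, with at most two components of \<open>X\<close> at a time: two suffice both for covariances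
  and for driving a pair apart. For the converse, \<open>Z 0\<close> may well have components at 0
  or 1, where some patterns of \<open>X\<close> are impossible. Only consensus at 0 or 1 is a trap,
  and the hypothesis on \<open>Z 0\<close> excludes that it is almost sure.\<close>

lemma matpow_add_1: "matpow A (Suc k) = matpow A k ** A"
  using matpow_add[of A k 1] by (simp add: matpow_1)

lemma matpow_transpose: "matpow (transpose A) k = transpose (matpow A k)"
proof (induction k)
  case 0
  then show ?case by (simp add: matpow_0)
next
  case (Suc k)
  then show ?case
    by (simp only: matpow_Suc[of "transpose A"] matpow_add_1[of A] matrix_transpose_mul)
qed

lemma irreducible_matrix_transpose:
  "irreducible_matrix A \<Longrightarrow> irreducible_matrix (transpose A)"
  unfolding irreducible_matrix_def matpow_transpose by (auto simp: transpose_def)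

lemma matpow_Suc_pos_obtain:
  fixes A :: "real ^ 'n ^ 'n"
  assumes "\<forall>i j. 0 \<le> A $ i $ j" "matpow A (Suc k) $ i $ j > 0"
  obtains m where "A $ i $ m > 0" "matpow A k $ m $ j > 0"
proof -
  have "0 < (\<Sum>m\<in>UNIV. A $ i $ m * matpow A k $ m $ j)"
    using assms(2) by (simp add: matpow_Suc matrix_matrix_mult_def)
  then obtain m where "0 < A $ i $ m * matpow A k $ m $ j"
    by (meson not_less sum_nonpos)
  then have "A $ i $ m \<noteq> 0" "matpow A k $ m $ j \<noteq> 0" by auto
  then show thesis
    using that[of m] assms(1) matpow_nonneg[OF assms(1), of k m j] by (auto simp: less_le)
qed

section \<open>Within-class variances and their decrease under averaging\<close>

lemma sum_square_le:
  fixes w x :: "'b \<Rightarrow> real"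
  assumes "finite I" "\<And>i. i \<in> I \<Longrightarrow> 0 \<le> w i" "sum w I = 1"
  shows "(\<Sum>i\<in>I. w i * x i)\<^sup>2 \<le> (\<Sum>i\<in>I. w i * (x i)\<^sup>2)"
proof -
  define m where "m = (\<Sum>i\<in>I. w i * x i)"
  \<comment> \<open>The variance of \<open>x\<close> under the weights \<open>w\<close>; it is the
    gap between the two sides.\<close>
  have "0 \<le> (\<Sum>i\<in>I. w i * (x i - m)\<^sup>2)"
    using assms by (intro sum_nonneg) auto
  also have "\<dots> = (\<Sum>i\<in>I. w i * (x i)\<^sup>2 - 2 * m * (w i * x i) + m\<^sup>2 * w i)"
    by (intro sum.cong) (auto simp: power2_eq_square algebra_simps)
  also have "\<dots> = (\<Sum>i\<in>I. w i * (x i)\<^sup>2) - 2 * m * m + m\<^sup>2"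
    using assms(3) by (simp add: sum.distrib sum_subtractf flip: sum_distrib_left m_def)
  finally show ?thesis by (simp add: m_def power2_eq_square)
qed

text \<open>Second moments of the process are computed for one linear functional \<open>f t\<close>
  at a time. The probabilistic part uses only this shape, the signs of the weights and the
  contraction.\<close>

definition quad_form :: "'t set \<Rightarrow> ('t \<Rightarrow> real) \<Rightarrow> ('t \<Rightarrow> real ^ 'n) \<Rightarrow> real ^ 'n \<Rightarrow> real" where
  "quad_form T w f z = (\<Sum>t\<in>T. w t * (f t \<bullet> z)\<^sup>2)"

text \<open>For an equivalence relation \<open>S\<close> and positive \<open>v\<close>, each class
  contributes twice the squared \<open>v\<close>-mass of the class times the variance of
  \<open>z\<close> on it under normalised \<open>v\<close>.\<close>

definition pair_form ::
    "('n \<Rightarrow> 'n \<Rightarrow> bool) \<Rightarrow> ('n \<Rightarrow> real) \<Rightarrow> real ^ 'n \<Rightarrow> real" where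
  "pair_form S v z = (\<Sum>i\<in>UNIV. \<Sum>j\<in>UNIV. of_bool (S i j) * (v i * v j * (z $ i - z $ j)\<^sup>2))"

text \<open>
  By convexity each term of the form at \<open>R *v z\<close> is at most an average of terms of the form at \<open>z\<close>,
  and stationarity of \<open>v\<close> makes these averages add up. The diagonal terms vanish on the left hand
  side but not on the right hand side: they provide the strict decrease.
\<close>

lemma pair_form_mult_le:
  fixes R :: "real ^ 'n ^ 'n"
  assumes R: "\<And>i j. 0 \<le> R $ i $ j" and row: "\<And>i. (\<Sum>j\<in>UNIV. R $ i $ j) = 1"
    and v: "\<And>i. 0 \<le> v i" and stat: "\<And>j. (\<Sum>i\<in>UNIV. v i * R $ i $ j) = v j"
    and S_refl: "\<And>i. S i i"
    and S: "\<And>i j a b. S i j \<Longrightarrow> R $ i $ a > 0 \<Longrightarrow> R $ j $ b > 0 \<Longrightarrow> S a b"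
  shows "pair_form S v (R *v z) + (\<Sum>i\<in>UNIV. \<Sum>a\<in>UNIV. \<Sum>b\<in>UNIV.
           (v i)\<^sup>2 * (R $ i $ a * R $ i $ b * (z $ a - z $ b)\<^sup>2)) \<le> pair_form S v z"
proof -
  \<comment> \<open>The mean squared difference when \<open>a\<close> and \<open>b\<close> are drawn
    independently from the rows \<open>i\<close> and \<open>j\<close>.\<close>
  define J where "J i j = (\<Sum>a\<in>UNIV. \<Sum>b\<in>UNIV. R $ i $ a * R $ j $ b * (z $ a - z $ b)\<^sup>2)" for i j
  have J_alt: "J i j = (\<Sum>p\<in>UNIV\<times>UNIV. (R $ i $ fst p * R $ j $ snd p) * (z $ fst p - z $ snd p)\<^sup>2)" for i j
    by (simp add: J_def sum.cartesian_product case_prod_beta)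
  have J0: "0 \<le> J i j" for i j
    unfolding J_def using R by (intro sum_nonneg mult_nonneg_nonneg) auto
  have one: "(\<Sum>p\<in>UNIV\<times>UNIV. R $ i $ fst p * R $ j $ snd p) = 1" for i j
    using sum_product[of "\<lambda>a. R $ i $ a" UNIV "\<lambda>b. R $ j $ b" UNIV] row
    by (simp add: sum.cartesian_product case_prod_beta)
  have diff: "(R *v z) $ i - (R *v z) $ j =
      (\<Sum>p\<in>UNIV\<times>UNIV. (R $ i $ fst p * R $ j $ snd p) * (z $ fst p - z $ snd p))" for i j
  proof -
    have "(\<Sum>p\<in>UNIV\<times>UNIV. (R $ i $ fst p * R $ j $ snd p) * (z $ fst p - z $ snd p)) =
       (\<Sum>a\<in>UNIV. \<Sum>b\<in>UNIV. (R $ i $ a * z $ a) * R $ j $ b - R $ i $ a * (R $ j $ b * z $ b))"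
      by (simp add: sum.cartesian_product case_prod_beta algebra_simps)
    also have "\<dots> = (R *v z) $ i - (R *v z) $ j"
      by (simp add: sum_subtractf row matrix_vector_mult_def flip: sum_distrib_left sum_distrib_right)
    finally show ?thesis by simp
  qed
  have jensen: "((R *v z) $ i - (R *v z) $ j)\<^sup>2 \<le> J i j" for i j
    unfolding diff J_alt by (rule sum_square_le) (use R one in auto)
  have "pair_form S v (R *v z) \<le> (\<Sum>i\<in>UNIV. \<Sum>j\<in>UNIV. of_bool (S i j) * (v i * v j * J i j) -
      (if i = j then (v i)\<^sup>2 * J i i else 0))"
    unfolding pair_form_def
  proof (intro sum_mono)
    fix i j
    have "v i * v j * ((R *v z) $ i - (R *v z) $ j)\<^sup>2 \<le> v i * v j * J i j"
      using jensen v by (intro mult_left_mono) auto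
    then show "of_bool (S i j) * (v i * v j * ((R *v z) $ i - (R *v z) $ j)\<^sup>2)
       \<le> of_bool (S i j) * (v i * v j * J i j) - (if i = j then (v i)\<^sup>2 * J i i else 0)"
      using S_refl[of i] by (auto simp: power2_eq_square)
  qed
  also have "\<dots> = (\<Sum>i\<in>UNIV. \<Sum>j\<in>UNIV. of_bool (S i j) * (v i * v j * J i j)) - (\<Sum>i\<in>UNIV. (v i)\<^sup>2 * J i i)"
    by (simp add: sum_subtractf)
  \<comment> \<open>The restriction by \<open>S\<close> passes from the pair \<open>i\<close>,
    \<open>j\<close> to the pair \<open>a\<close>, \<open>b\<close>; pairs with \<open>S a b\<close>
    but not \<open>S i j\<close> only add nonnegative terms.\<close>
  also have "(\<Sum>i\<in>UNIV. \<Sum>j\<in>UNIV. of_bool (S i j) * (v i * v j * J i j)) \<le>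
     (\<Sum>i\<in>UNIV. \<Sum>j\<in>UNIV. \<Sum>a\<in>UNIV. \<Sum>b\<in>UNIV.
        (v i * R $ i $ a) * (v j * R $ j $ b) * (of_bool (S a b) * (z $ a - z $ b)\<^sup>2))"
  proof (intro sum_mono)
    fix i j
    have "of_bool (S i j) * (v i * v j * J i j) = (\<Sum>a\<in>UNIV. \<Sum>b\<in>UNIV.
        of_bool (S i j) * ((v i * R $ i $ a) * (v j * R $ j $ b) * (z $ a - z $ b)\<^sup>2))"
      unfolding J_def by (simp add: sum_distrib_left mult_ac)
    also have "\<dots> \<le> (\<Sum>a\<in>UNIV. \<Sum>b\<in>UNIV.
        (v i * R $ i $ a) * (v j * R $ j $ b) * (of_bool (S a b) * (z $ a - z $ b)\<^sup>2))"
    proof (intro sum_mono)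
      fix a b
      show "of_bool (S i j) * ((v i * R $ i $ a) * (v j * R $ j $ b) * (z $ a - z $ b)\<^sup>2)
        \<le> (v i * R $ i $ a) * (v j * R $ j $ b) * (of_bool (S a b) * (z $ a - z $ b)\<^sup>2)"
      proof (cases "S i j \<and> R $ i $ a > 0 \<and> R $ j $ b > 0")
        case True
        then have "S a b" using S by blast
        then show ?thesis using True by simp
      next
        case False
        then have "\<not> S i j \<or> R $ i $ a = 0 \<or> R $ j $ b = 0"
          using R by (metis order_le_less)
        then show ?thesis using v R by auto
      qed
    qed
    finally show "of_bool (S i j) * (v i * v j * J i j) \<le> \<dots>" .
  qed
  also have "\<dots> = (\<Sum>a\<in>UNIV. \<Sum>b\<in>UNIV. \<Sum>i\<in>UNIV. \<Sum>j\<in>UNIV.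
        (v i * R $ i $ a) * (v j * R $ j $ b) * (of_bool (S a b) * (z $ a - z $ b)\<^sup>2))"
  proof -
    have "(\<Sum>i\<in>UNIV. \<Sum>j\<in>UNIV. \<Sum>a\<in>UNIV. \<Sum>b\<in>UNIV. g i j a b) =
      (\<Sum>a\<in>UNIV. \<Sum>b\<in>UNIV. \<Sum>i\<in>UNIV. \<Sum>j\<in>UNIV. g i j a b)" for g :: "'n \<Rightarrow> 'n \<Rightarrow> 'n \<Rightarrow> 'n \<Rightarrow> real"
    proof -
      have "(\<Sum>i\<in>UNIV. \<Sum>j\<in>UNIV. \<Sum>a\<in>UNIV. \<Sum>b\<in>UNIV. g i j a b) = (\<Sum>i\<in>UNIV. \<Sum>a\<in>UNIV. \<Sum>j\<in>UNIV. \<Sum>b\<in>UNIV. g i j a b)"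
        by (rule sum.cong[OF refl], rule sum.swap)
      also have "\<dots> = (\<Sum>a\<in>UNIV. \<Sum>i\<in>UNIV. \<Sum>j\<in>UNIV. \<Sum>b\<in>UNIV. g i j a b)"
        by (rule sum.swap)
      also have "\<dots> = (\<Sum>a\<in>UNIV. \<Sum>i\<in>UNIV. \<Sum>b\<in>UNIV. \<Sum>j\<in>UNIV. g i j a b)"
        by (rule sum.cong[OF refl], rule sum.cong[OF refl], rule sum.swap)
      also have "\<dots> = (\<Sum>a\<in>UNIV. \<Sum>b\<in>UNIV. \<Sum>i\<in>UNIV. \<Sum>j\<in>UNIV. g i j a b)"
        by (rule sum.cong[OF refl], rule sum.swap)
      finally show ?thesis .
    qed
    then show ?thesis .
  qed
  also have "\<dots> = pair_form S v z"
    unfolding pair_form_def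
  proof (intro sum.cong refl)
    fix a b
    have "(\<Sum>i\<in>UNIV. \<Sum>j\<in>UNIV.
        (v i * R $ i $ a) * (v j * R $ j $ b) * (of_bool (S a b) * (z $ a - z $ b)\<^sup>2)) =
        (\<Sum>i\<in>UNIV. v i * R $ i $ a) * (\<Sum>j\<in>UNIV. v j * R $ j $ b) * (of_bool (S a b) * (z $ a - z $ b)\<^sup>2)"
      unfolding sum_product by (simp only: sum_distrib_right)
    then show "(\<Sum>i\<in>UNIV. \<Sum>j\<in>UNIV.
        (v i * R $ i $ a) * (v j * R $ j $ b) * (of_bool (S a b) * (z $ a - z $ b)\<^sup>2)) =
        of_bool (S a b) * (v a * v b * (z $ a - z $ b)\<^sup>2)"
      by (simp add: stat)
  qed
  finally show ?thesis
    by (simp add: J_def sum_distrib_left)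
qed

section \<open>Irreducibility and the stationary vector\<close>

locale irreducible_stochastic =
  fixes P :: "real ^ 'n ^ 'n"
  assumes nonneg: "\<forall>i j. 0 \<le> P $ i $ j" and row_sum: "P *v 1 = 1"
    and irr: "irreducible_matrix P"
begin

lemma row_sum': "(\<Sum>j\<in>UNIV. P $ i $ j) = 1"
  using arg_cong[OF row_sum, of "\<lambda>x. x $ i"] by (simp add: matrix_vector_mult_def)

lemma matpow_row_sum: "(\<Sum>j\<in>UNIV. matpow P k $ i $ j) = 1"
proof -
  have "matpow P k *v 1 = 1"
    by (induction k) (simp_all add: matpow_0 matpow_Suc row_sum flip: matrix_vector_mul_assoc)
  from arg_cong[OF this, of "\<lambda>x. x $ i"] show ?thesis by (simp add: matrix_vector_mult_def)
qed

text \<open>Irreducibility as a propagation principle along positive entries. It yields positivity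
  of the stationary vector and, in \<open>inside_UNIV_pos\<close>, the spreading of the values 0 and
  1.\<close>

lemma forward_closed_eq_UNIV:
  assumes "i \<in> H" and step: "\<And>i j. i \<in> H \<Longrightarrow> P $ i $ j > 0 \<Longrightarrow> j \<in> H"
  shows "H = UNIV"
proof -
  have "j \<in> H" if "i \<in> H" "matpow P k $ i $ j > 0" for k i j
    using that
  proof (induction k arbitrary: i)
    case 0
    then show ?case by (auto simp: matpow_0 mat_def split: if_splits)
  next
    case (Suc k)
    then show ?case by (metis matpow_Suc_pos_obtain[OF nonneg] step)
  qed
  then show ?thesis using assms(1) irr unfolding irreducible_matrix_def by blast
qed

text \<open>Existence is Brouwer's theorem on the simplex of probability vectors. The support of a
  fixed point is closed under positive entries, hence everything.\<close>

lemma stationary_exists: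
  "\<exists>v :: 'n \<Rightarrow> real. (\<forall>i. 0 < v i) \<and> (\<forall>j. (\<Sum>i\<in>UNIV. v i * P $ i $ j) = v j)"
proof -
  define C :: "(real ^ 'n) set" where "C = {x. (\<forall>i. 0 \<le> x $ i) \<and> (\<Sum>i\<in>UNIV. x $ i) = 1}"
  define f where "f x = transpose P *v x" for x
  have f: "f x $ j = (\<Sum>i\<in>UNIV. x $ i * P $ i $ j)" for x j
    by (simp add: f_def matrix_vector_mult_def transpose_def mult.commute)
  have "closed C"
    unfolding C_def
    by (intro closed_Collect_conj closed_Collect_all closed_Collect_le closed_Collect_eq continuous_intros)
  moreover have "bounded C"
  proof (rule boundedI)
    fix x :: "real ^ 'n" assume x: "x \<in> C"
    have "norm x \<le> (\<Sum>i\<in>UNIV. \<bar>x $ i\<bar>)" by (rule norm_le_l1_cart)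
    also have "\<dots> = 1" using x by (simp add: C_def)
    finally show "norm x \<le> 1" .
  qed
  ultimately have "compact C" by (simp add: compact_eq_bounded_closed)
  moreover have "convex C"
    unfolding convex_def C_def by (auto simp: sum.distrib simp flip: sum_distrib_left)
  moreover have "C \<noteq> {}"
  proof -
    have "axis undefined 1 \<in> C" by (simp add: C_def axis_def)
    then show ?thesis by blast
  qed
  moreover have "continuous_on C f" unfolding f_def by (intro continuous_intros)
  moreover have "f \<in> C \<rightarrow> C"
  proof
    fix x assume x: "x \<in> C"
    have "(\<Sum>j\<in>UNIV. f x $ j) = (\<Sum>i\<in>UNIV. x $ i * (\<Sum>j\<in>UNIV. P $ i $ j))"
      unfolding f sum_distrib_left by (rule sum.swap)
    also have "\<dots> = 1" using x by (simp add: row_sum' C_def)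
    finally show "f x \<in> C" using x nonneg by (auto simp: C_def f intro!: sum_nonneg)
  qed
  ultimately obtain x where x: "x \<in> C" "f x = x" by (rule brouwer) blast
  have x0: "0 \<le> x $ i" for i using x by (simp add: C_def)
  have "\<exists>i. x $ i > 0"
  proof (rule ccontr)
    assume "\<nexists>i. x $ i > 0"
    then have "x $ i = 0" for i using x0[of i] by (metis order_le_less)
    then show False using x by (simp add: C_def)
  qed
  then obtain i where i: "x $ i > 0" ..
  have "{i. x $ i > 0} = UNIV"
  proof (rule forward_closed_eq_UNIV[of i])
    fix i j assume "i \<in> {i. x $ i > 0}" "P $ i $ j > 0"
    then have "0 < x $ i * P $ i $ j" by simp
    also have "\<dots> \<le> f x $ j"
      unfolding f by (rule member_le_sum) (auto simp: x0 nonneg)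
    finally show "j \<in> {i. x $ i > 0}" by (simp add: x)
  qed (use i in simp)
  then have "\<forall>i. 0 < x $ i" by blast
  moreover have "\<forall>j. (\<Sum>i\<in>UNIV. x $ i * P $ i $ j) = x $ j"
    using x(2) by (simp flip: f)
  ultimately show ?thesis by blast
qed

section \<open>Return times and common ancestors in a cyclic class\<close>

lemma same_cyclic_class_step:
  assumes "same_cyclic_class P i j" "P $ i $ a > 0" "P $ j $ b > 0"
  shows "same_cyclic_class P a b"
proof -
  obtain c :: "'n \<Rightarrow> nat" where
    c: "\<And>i j. c j \<noteq> (c i + 1) mod matrix_period P \<Longrightarrow> P $ i $ j = 0"
       "\<And>i j. c i = c j \<longleftrightarrow> same_cyclic_class P i j"
    using cyclic_classes_exist[OF nonneg irr] by blast
  have "c a = (c i + 1) mod matrix_period P" "c b = (c j + 1) mod matrix_period P"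
    using c(1)[of a i] c(1)[of b j] assms by auto
  then show ?thesis using c(2) assms(1) by metis
qed

lemma same_cyclic_class_steps:
  "same_cyclic_class P i j \<Longrightarrow> matpow P k $ i $ a > 0 \<Longrightarrow> matpow P k $ j $ b > 0
    \<Longrightarrow> same_cyclic_class P a b"
proof (induction k arbitrary: i j)
  case 0
  then show ?case by (auto simp: matpow_0 mat_def split: if_splits)
next
  case (Suc k)
  obtain i' where "P $ i $ i' > 0" "matpow P k $ i' $ a > 0"
    using matpow_Suc_pos_obtain[OF nonneg Suc.prems(2)] .
  moreover obtain j' where "P $ j $ j' > 0" "matpow P k $ j' $ b > 0"
    using matpow_Suc_pos_obtain[OF nonneg Suc.prems(3)] .
  ultimately show ?case using Suc.IH same_cyclic_class_step[OF Suc.prems(1)] by blast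
qed

lemma same_cyclic_class_refl: "same_cyclic_class P i i"
  unfolding same_cyclic_class_def communicate_def
  by (auto intro!: exI[of _ 0] simp: matpow_0 mat_def)

text \<open>Return times to \<open>l\<close> are closed under addition, so their differences form a
  subgroup of the integers, and the period is their gcd. Working with differences spares the proof
  that all large multiples of the period are return times.\<close>

lemma period_eq_diff:
  "\<exists>k k'. matpow P k $ l $ l > 0 \<and> matpow P k' $ l $ l > 0 \<and> k = k' + matrix_period P * q"
proof -
  define S where "S = {k. matpow P k $ l $ l > 0}"
  define G where "G = {int a - int b | a b. a \<in> S \<and> b \<in> S}"
  have S_add: "a + b \<in> S" if "a \<in> S" "b \<in> S" for a b
    using that matpow_pos_add[OF nonneg] by (auto simp: S_def)
  have S0: "0 \<in> S" by (simp add: S_def matpow_0 mat_def)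
  have G_diff: "x - y \<in> G" if xy: "x \<in> G" "y \<in> G" for x y
  proof -
    obtain a b where ab: "x = int a - int b" "a \<in> S" "b \<in> S" using xy(1) by (auto simp: G_def)
    obtain c e where ce: "y = int c - int e" "c \<in> S" "e \<in> S" using xy(2) by (auto simp: G_def)
    have "x - y = int (a + e) - int (b + c)" using ab(1) ce(1) by simp
    then show ?thesis unfolding G_def using S_add ab ce by blast
  qed
  have SG: "int a \<in> G" if "a \<in> S" for a
    using that S0 unfolding G_def by force
  have G0: "0 \<in> G" using SG[OF S0] by simp
  have G_mult: "x * int n \<in> G" if "x \<in> G" for x n
  proof (induction n)
    case (Suc n)
    have "x * int (Suc n) = x * int n - (0 - x)" by (simp add: algebra_simps)
    then show ?case using G_diff Suc G0 that by metis
  qed (simp add: G0)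
  obtain k where k: "k \<ge> 1" "k \<in> S"
    using irr unfolding irreducible_matrix_def S_def by blast
  \<comment> \<open>Division with remainder shows that the least positive difference divides every
    return time. So it divides the period, and multiples of the period are differences as
    well.\<close>
  define g where "g = (LEAST n. 0 < n \<and> int n \<in> G)"
  have g: "0 < g" "int g \<in> G"
    using LeastI[of "\<lambda>n. 0 < n \<and> int n \<in> G" k] SG k unfolding g_def by auto
  have "g dvd a" if "a \<in> S" for a
  proof (rule ccontr)
    assume "\<not> g dvd a"
    then have m: "0 < a mod g" by (simp add: mod_greater_zero_iff_not_dvd)
    have "int (a mod g) = int a - int g * int (a div g)"
      by (metis minus_mult_div_eq_mod of_nat_mult zdiv_int zmod_int)
    then have "int (a mod g) \<in> G" using G_diff SG[OF that] G_mult[OF g(2)] by metis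
    then have "g \<le> a mod g" unfolding g_def using m by (intro Least_le) (auto simp: g_def)
    then show False using g(1) by (meson mod_less_divisor not_less)
  qed
  then have "g dvd matrix_period P"
    unfolding matrix_period_eq[OF nonneg irr, of l] index_period_def
    by (intro Gcd_greatest) (auto simp: S_def)
  then obtain h where "matrix_period P = g * h" ..
  then have "int (matrix_period P * q) = int g * int (h * q)" by simp
  then have "int (matrix_period P * q) \<in> G" using G_mult[OF g(2)] by metis
  then obtain a b where "int (matrix_period P * q) = int a - int b" "a \<in> S" "b \<in> S"
    by (auto simp: G_def)
  moreover from this have "a = b + matrix_period P * q" by linarith
  ultimately show ?thesis by (auto simp: S_def)
qed

text \<open>If \<open>b\<close> is reached from \<open>a\<close> in a multiple of the period,
  \<open>period_eq_diff\<close> gives two return times to \<open>a\<close> that differ by exactly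
  this multiple. Then \<open>a\<close> itself reaches both \<open>a\<close> and \<open>b\<close> in
  the longer of these times. Every index has a predecessor, so a common ancestor can be moved
  further back, and one distance serves all pairs.\<close>

lemma same_cyclic_class_common_predecessor:
  "\<exists>K\<ge>1. \<forall>a b. same_cyclic_class P a b \<longrightarrow> (\<exists>i. matpow P K $ i $ a > 0 \<and> matpow P K $ i $ b > 0)"
proof -
  define good where "good K a b \<longleftrightarrow> (\<exists>i. matpow P K $ i $ a > 0 \<and> matpow P K $ i $ b > 0)" for K a b
  have pred: "\<exists>j. P $ j $ i > 0" for i
  proof -
    obtain k where k: "k \<ge> 1" "matpow P k $ i $ i > 0"
      using irr unfolding irreducible_matrix_def by blast
    then obtain k' where k': "k = Suc k'" by (cases k) auto
    have "0 < (\<Sum>m\<in>UNIV. matpow P k' $ i $ m * P $ m $ i)"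
      using k k' by (simp add: matpow_add_1 matrix_matrix_mult_def)
    then obtain m where "0 < matpow P k' $ i $ m * P $ m $ i"
      by (meson not_less sum_nonpos)
    then have "P $ m $ i \<noteq> 0" by auto
    then show ?thesis using nonneg by (metis order_le_less)
  qed
  have up: "good (Suc K) a b" if K: "good K a b" for K a b
  proof -
    obtain i where i: "matpow P K $ i $ a > 0" "matpow P K $ i $ b > 0"
      using K by (auto simp: good_def)
    obtain j where "P $ j $ i > 0" using pred by blast
    then have "matpow P 1 $ j $ i > 0" by (simp add: matpow_1)
    from matpow_pos_add[OF nonneg this i(1)] matpow_pos_add[OF nonneg this i(2)]
    show ?thesis by (auto simp: good_def)
  qed
  have mono: "good K' a b" if "good K a b" "K \<le> K'" for K K' a b
    using that(2,1) by (induction K' rule: dec_induct) (auto intro: up)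
  have ex: "\<exists>K. same_cyclic_class P a b \<longrightarrow> good K a b" for a b
  proof (cases "same_cyclic_class P a b")
    case True
    then obtain q where "matpow (matpow P (matrix_period P)) q $ a $ b > 0"
      by (auto simp: same_cyclic_class_def communicate_def)
    then have q: "matpow P (matrix_period P * q) $ a $ b > 0" by (simp add: matpow_mult)
    obtain k k' where k: "matpow P k $ a $ a > 0" "matpow P k' $ a $ a > 0"
        "k = k' + matrix_period P * q"
      using period_eq_diff[of a q] by blast
    have "good k a b"
      using k matpow_pos_add[OF nonneg k(2) q] by (auto simp: good_def)
    then show ?thesis by blast
  qed simp
  then obtain K where K: "\<And>a b. same_cyclic_class P a b \<Longrightarrow> good (K a b) a b" by metis
  \<comment> \<open>The sum bounds all the distances at once; \<open>Suc\<close> makes the result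
    positive, as the form built from it has that many layers and its rate is divided by their
    number.\<close>
  define K0 where "K0 = Suc (\<Sum>a\<in>UNIV. \<Sum>b\<in>UNIV. K a b)"
  have "K a b \<le> K0" for a b
  proof -
    have "K a b \<le> (\<Sum>b\<in>UNIV. K a b)" by (rule member_le_sum) auto
    also have "\<dots> \<le> (\<Sum>a\<in>UNIV. \<Sum>b\<in>UNIV. K a b)" by (rule member_le_sum) auto
    finally show ?thesis by (simp add: K0_def)
  qed
  then have "\<forall>a b. same_cyclic_class P a b \<longrightarrow> good K0 a b" using K mono by blast
  moreover have "K0 \<ge> 1" by (simp add: K0_def)
  ultimately show ?thesis unfolding good_def by blast
qed


section \<open>A quadratic form contracted by the mean dynamics\<close>

lemma matpow_stationary:
  assumes "\<And>j. (\<Sum>i\<in>UNIV. v i * P $ i $ j) = v j"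
  shows "(\<Sum>i\<in>UNIV. v i * matpow P k $ i $ j) = v j"
proof (induction k arbitrary: j)
  case 0
  show ?case by (simp add: matpow_0 mat_def if_distrib cong: if_cong)
next
  case (Suc k)
  have "(\<Sum>i\<in>UNIV. v i * matpow P (Suc k) $ i $ j) =
      (\<Sum>i\<in>UNIV. \<Sum>m\<in>UNIV. v i * matpow P k $ i $ m * P $ m $ j)"
    by (simp add: matpow_add_1 matrix_matrix_mult_def sum_distrib_left mult.assoc)
  also have "\<dots> = (\<Sum>m\<in>UNIV. (\<Sum>i\<in>UNIV. v i * matpow P k $ i $ m) * P $ m $ j)"
    unfolding sum_distrib_right by (rule sum.swap)
  finally show ?case by (simp add: Suc assms)
qed

text \<open>
  The sum of \<open>pair_form\<close> along the orbit \<open>z, P z, \<dots>, P\<^sup>K\<^sup>-\<^sup>1 z\<close> telescopes under \<open>z \<mapsto> P z\<close>, so that the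
  contraction which is only available for \<open>P\<^sup>K\<close> becomes effective after one step.
\<close>

lemma contracting_form_exists:
  obtains T :: "(nat \<times> 'n \<times> 'n) set" and w :: "nat \<times> 'n \<times> 'n \<Rightarrow> real"
    and \<kappa> c :: real and f :: "nat \<times> 'n \<times> 'n \<Rightarrow> real ^ 'n"
  where "\<And>t. t \<in> T \<Longrightarrow> 0 \<le> w t" "0 < \<kappa>" "0 < c"
    "\<And>z r. 0 \<le> r \<Longrightarrow> r \<le> 1 \<Longrightarrow>
       quad_form T w f ((1 - r) *\<^sub>R z + r *\<^sub>R (P *v z)) \<le> (1 - \<kappa> * r) * quad_form T w f z"
    "\<And>z i j. same_cyclic_class P i j \<Longrightarrow> c * (z $ i - z $ j)\<^sup>2 \<le> quad_form T w f z"
proof -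
  obtain v :: "'n \<Rightarrow> real" where v: "\<And>i. 0 < v i" and stat: "\<And>j. (\<Sum>i\<in>UNIV. v i * P $ i $ j) = v j"
    using stationary_exists by blast
  obtain K where K: "K \<ge> 1"
    "\<And>a b. same_cyclic_class P a b \<Longrightarrow> \<exists>i. matpow P K $ i $ a > 0 \<and> matpow P K $ i $ b > 0"
    using same_cyclic_class_common_predecessor by blast
  define S where "S = same_cyclic_class P"
  define q where "q = pair_form S v"
  have mult_le: "q (matpow P k *v z) + (\<Sum>i\<in>UNIV. \<Sum>a\<in>UNIV. \<Sum>b\<in>UNIV.
      (v i)\<^sup>2 * (matpow P k $ i $ a * matpow P k $ i $ b * (z $ a - z $ b)\<^sup>2)) \<le> q z" for k z
    unfolding q_def S_def
    by (rule pair_form_mult_le)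
       (auto simp: matpow_nonneg[OF nonneg] matpow_row_sum less_imp_le[OF v] matpow_stationary[OF stat]
         same_cyclic_class_refl intro: same_cyclic_class_steps)
  have q0: "0 \<le> q z" for z
    unfolding q_def pair_form_def using v by (intro sum_nonneg) (simp add: less_imp_le)
  have q_mono: "q (matpow P k *v z) \<le> q z" for k z
  proof -
    have "0 \<le> (\<Sum>i\<in>UNIV. \<Sum>a\<in>UNIV. \<Sum>b\<in>UNIV.
      (v i)\<^sup>2 * (matpow P k $ i $ a * matpow P k $ i $ b * (z $ a - z $ b)\<^sup>2))"
      by (intro sum_nonneg mult_nonneg_nonneg) (auto simp: matpow_nonneg[OF nonneg])
    then show ?thesis using mult_le[of k z] by simp
  qed
  define h where "h a b = (\<Sum>i\<in>UNIV. (v i)\<^sup>2 * (matpow P K $ i $ a * matpow P K $ i $ b))" for a b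
  have h0: "0 \<le> h a b" for a b
    unfolding h_def by (intro sum_nonneg mult_nonneg_nonneg) (auto simp: matpow_nonneg[OF nonneg])
  have h_pos: "0 < h a b" if ab: "S a b" for a b
  proof -
    obtain i where i: "matpow P K $ i $ a > 0" "matpow P K $ i $ b > 0"
      using K(2) ab by (auto simp: S_def)
    have "0 < (v i)\<^sup>2 * (matpow P K $ i $ a * matpow P K $ i $ b)" using i v[of i] by simp
    also have "\<dots> \<le> h a b" unfolding h_def
      by (rule member_le_sum) (auto simp: matpow_nonneg[OF nonneg])
    finally show ?thesis .
  qed
  \<comment> \<open>Under \<open>matpow P K\<close> the form loses at least weight
    \<open>h a b\<close> on each pair where it has weight \<open>v a * v b\<close>. The least ratio
    over related pairs is a relative rate of decrease; \<open>insert 1\<close> makes the set visibly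
    nonempty for \<open>Min\<close>.\<close>
  define E where "E = insert 1 ((\<lambda>(a, b). h a b / (v a * v b)) ` {(a, b). S a b})"
  define \<epsilon> where "\<epsilon> = Min E"
  have fE: "finite E" by (simp add: E_def)
  have \<epsilon>0: "0 < \<epsilon>"
    unfolding \<epsilon>_def using fE h_pos v by (subst Min_gr_iff) (auto simp: E_def)
  have \<epsilon>h: "\<epsilon> * (v a * v b) \<le> h a b" if "S a b" for a b
  proof -
    have "\<epsilon> \<le> h a b / (v a * v b)"
      unfolding \<epsilon>_def using fE by (rule Min_le) (use that in \<open>auto simp: E_def\<close>)
    then show ?thesis using v by (simp add: pos_le_divide_eq)
  qed
  have contract: "q (matpow P K *v z) \<le> q z - \<epsilon> * q z" for z
  proof -
    have "\<epsilon> * q z \<le> (\<Sum>a\<in>UNIV. \<Sum>b\<in>UNIV. h a b * (z $ a - z $ b)\<^sup>2)"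
      unfolding q_def pair_form_def sum_distrib_left
    proof (intro sum_mono)
      fix a b
      show "\<epsilon> * (of_bool (S a b) * (v a * v b * (z $ a - z $ b)\<^sup>2)) \<le> h a b * (z $ a - z $ b)\<^sup>2"
      proof (cases "S a b")
        case True
        from mult_right_mono[OF \<epsilon>h[OF True], of "(z $ a - z $ b)\<^sup>2"] True
        show ?thesis by (simp add: mult.assoc)
      qed (simp add: h0)
    qed
    also have "\<dots> = (\<Sum>i\<in>UNIV. \<Sum>a\<in>UNIV. \<Sum>b\<in>UNIV.
      (v i)\<^sup>2 * (matpow P K $ i $ a * matpow P K $ i $ b * (z $ a - z $ b)\<^sup>2))"
    proof -
      have "(\<Sum>a\<in>UNIV. \<Sum>b\<in>UNIV. h a b * (z $ a - z $ b)\<^sup>2) = (\<Sum>a\<in>UNIV. \<Sum>b\<in>UNIV. \<Sum>i\<in>UNIV.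
          (v i)\<^sup>2 * (matpow P K $ i $ a * matpow P K $ i $ b * (z $ a - z $ b)\<^sup>2))"
        by (simp add: h_def sum_distrib_right mult.assoc)
      also have "\<dots> = (\<Sum>a\<in>UNIV. \<Sum>i\<in>UNIV. \<Sum>b\<in>UNIV.
          (v i)\<^sup>2 * (matpow P K $ i $ a * matpow P K $ i $ b * (z $ a - z $ b)\<^sup>2))"
        by (intro sum.cong refl sum.swap)
      also have "\<dots> = (\<Sum>i\<in>UNIV. \<Sum>a\<in>UNIV. \<Sum>b\<in>UNIV.
          (v i)\<^sup>2 * (matpow P K $ i $ a * matpow P K $ i $ b * (z $ a - z $ b)\<^sup>2))"
        by (rule sum.swap)
      finally show ?thesis .
    qed
    finally show ?thesis using mult_le[of K z] by linarith
  qed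
  define Q where "Q z = (\<Sum>s<K. q (matpow P s *v z))" for z
  have Q_le: "Q z \<le> K * q z" for z
    using sum_mono[of "{..<K}" "\<lambda>s. q (matpow P s *v z)" "\<lambda>_. q z"] q_mono by (simp add: Q_def)
  have Q_ge: "q z \<le> Q z" for z
  proof -
    have "q (matpow P 0 *v z) \<le> Q z"
      unfolding Q_def using K(1) q0 by (intro member_le_sum) auto
    then show ?thesis by (simp add: matpow_0)
  qed
  \<comment> \<open>One step costs \<open>Q\<close> at least \<open>\<epsilon> * q z\<close>, and
    \<open>Q z\<close> is at most \<open>K * q z\<close>.\<close>
  define \<kappa> where "\<kappa> = \<epsilon> / K"
  have Q_step: "Q (P *v z) \<le> (1 - \<kappa>) * Q z" for z
  proof -
    have "Q (P *v z) = (\<Sum>s<K. q (matpow P (Suc s) *v z))"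
      by (simp add: Q_def matpow_add_1 matrix_vector_mul_assoc)
    also have "\<dots> = Q z - q z + q (matpow P K *v z)"
      using sum.lessThan_Suc_shift[of "\<lambda>s. q (matpow P s *v z)" K] by (simp add: Q_def matpow_0)
    also have "\<dots> \<le> Q z - \<epsilon> * q z" using contract[of z] by simp
    also have "\<dots> \<le> Q z - \<kappa> * Q z"
      using mult_left_mono[OF Q_le[of z], of \<kappa>] \<epsilon>0 K(1) by (simp add: \<kappa>_def)
    finally show ?thesis by (simp add: algebra_simps)
  qed
  \<comment> \<open>One functional for each exponent \<open>s\<close> below \<open>K\<close> and
    each pair; pairs from different classes get weight 0.\<close>
  define T :: "(nat \<times> 'n \<times> 'n) set" where "T = {..<K} \<times> UNIV"
  define w where "w = (\<lambda>(s::nat, i, j). of_bool (S i j) * (v i * v j))"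
  define f where "f = (\<lambda>(s, i, j). matpow P s $ i - matpow P s $ j)"
  have f: "f (s, i, j) \<bullet> z = (matpow P s *v z) $ i - (matpow P s *v z) $ j" for s i j z
    by (simp add: f_def inner_diff_left matrix_vector_mul_component)
  have Q_eq: "Q z = quad_form T w f z" for z
  proof -
    have "Q z = (\<Sum>s<K. \<Sum>i\<in>UNIV. \<Sum>j\<in>UNIV. w (s, i, j) * (f (s, i, j) \<bullet> z)\<^sup>2)"
      by (simp add: Q_def q_def pair_form_def f w_def mult.assoc)
    also have "\<dots> = (\<Sum>t\<in>{..<K} \<times> (UNIV \<times> UNIV). w t * (f t \<bullet> z)\<^sup>2)"
      unfolding sum.cartesian_product by (simp add: case_prod_beta)
    finally show ?thesis by (simp add: T_def quad_form_def)
  qed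
  have w0: "0 \<le> w t" for t
    using v by (cases t) (simp add: w_def less_imp_le)
  have conv: "Q ((1 - r) *\<^sub>R x + r *\<^sub>R y) \<le> (1 - r) * Q x + r * Q y" if "0 \<le> r" "r \<le> 1" for r x y
  proof -
    have "w t * (f t \<bullet> ((1 - r) *\<^sub>R x + r *\<^sub>R y))\<^sup>2 \<le> (1 - r) * (w t * (f t \<bullet> x)\<^sup>2) + r * (w t * (f t \<bullet> y)\<^sup>2)" for t
    proof -
      define a b where "a = f t \<bullet> x" and "b = f t \<bullet> y"
      have "(1 - r) * a\<^sup>2 + r * b\<^sup>2 - ((1 - r) * a + r * b)\<^sup>2 = r * (1 - r) * (a - b)\<^sup>2"
        by (simp add: power2_eq_square algebra_simps)
      also have "\<dots> \<ge> 0" using that by simp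
      finally have "((1 - r) * a + r * b)\<^sup>2 \<le> (1 - r) * a\<^sup>2 + r * b\<^sup>2" by simp
      from mult_left_mono[OF this w0[of t]] show ?thesis
        by (simp add: inner_add_right a_def b_def algebra_simps)
    qed
    then show ?thesis
      unfolding Q_eq quad_form_def sum_distrib_left sum.distrib[symmetric] by (intro sum_mono)
  qed
  define c where "c = Min (range (\<lambda>(i, j). v i * v j))"
  have c0: "0 < c" unfolding c_def using v by (subst Min_gr_iff) auto
  show thesis
  proof (rule that[of T w \<kappa> c f])
    show "0 \<le> w t" for t by (rule w0)
    show "0 < \<kappa>" using \<epsilon>0 K(1) by (simp add: \<kappa>_def)
    show "0 < c" by (rule c0)
    show "quad_form T w f ((1 - r) *\<^sub>R z + r *\<^sub>R (P *v z))
        \<le> (1 - \<kappa> * r) * quad_form T w f z" if "0 \<le> r" "r \<le> 1" for z r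
    proof -
      have "Q ((1 - r) *\<^sub>R z + r *\<^sub>R (P *v z)) \<le> (1 - r) * Q z + r * ((1 - \<kappa>) * Q z)"
        using conv[OF that, of z "P *v z"] mult_left_mono[OF Q_step[of z] that(1)] by linarith
      also have "\<dots> = (1 - \<kappa> * r) * Q z" by (simp add: algebra_simps)
      finally show ?thesis by (simp add: Q_eq)
    qed
    show "c * (z $ i - z $ j)\<^sup>2 \<le> quad_form T w f z" if "same_cyclic_class P i j" for z i j
    proof -
      have "c \<le> v i * v j" unfolding c_def by (rule Min_le) auto
      then have "c * (z $ i - z $ j)\<^sup>2 \<le> of_bool (S i j) * (v i * v j * (z $ i - z $ j)\<^sup>2)"
        using that by (simp add: S_def mult_right_mono)
      also have "\<dots> \<le> (\<Sum>j\<in>UNIV. of_bool (S i j) * (v i * v j * (z $ i - z $ j)\<^sup>2))"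
        using v by (intro member_le_sum) (auto simp: less_imp_le)
      also have "\<dots> \<le> q z"
        unfolding q_def pair_form_def using v
        by (intro member_le_sum[of i UNIV "\<lambda>i. \<Sum>j\<in>UNIV. of_bool (S i j) * (v i * v j * (z $ i - z $ j)\<^sup>2)"])
           (auto simp: less_imp_le intro!: sum_nonneg)
      finally show ?thesis using Q_ge[of z] by (simp add: Q_eq)
    qed
  qed
qed

end

section \<open>Synchronization for divergent step sizes\<close>

text \<open>Minus the partial sums of \<open>e\<close>, the sequence decreases and is bounded below,
  so \<open>x\<close> converges. Summing the recursion also bounds the sums of
  \<open>r k * x k\<close>; a positive limit would then make \<open>r\<close> summable.\<close>

lemma contracting_sequence_tendsto_0:
  fixes x e r :: "nat \<Rightarrow> real"
  assumes x: "\<And>n. 0 \<le> x n" and e: "\<And>n. 0 \<le> e n" "summable e"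
    and r: "\<And>n. 0 \<le> r n" "\<not> summable r" and \<kappa>: "0 < \<kappa>"
    and step: "\<And>n. x (Suc n) \<le> (1 - \<kappa> * r n) * x n + e n"
  shows "x \<longlonglongrightarrow> 0"
proof -
  define E where "E n = (\<Sum>k<n. e k)" for n
  have E: "E n \<le> suminf e" for n
    unfolding E_def using e by (intro sum_le_suminf) auto
  have step': "x (Suc n) + \<kappa> * (r n * x n) \<le> x n + e n" for n
    using step[of n] by (simp add: algebra_simps)
  have "x n + \<kappa> * (\<Sum>k<n. r k * x k) \<le> x 0 + E n" for n
  proof (induction n)
    case (Suc n)
    then show ?case using step'[of n] by (simp add: E_def distrib_left)
  qed (simp add: E_def)
  then have bound: "\<kappa> * (\<Sum>k<n. r k * x k) \<le> x 0 + suminf e" for n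
    using x[of n] E[of n] by (meson add_left_mono le_add_same_cancel2 order_trans)
  have rx: "summable (\<lambda>k. r k * x k)"
  proof (rule summableI_nonneg_bounded)
    show "(\<Sum>k<n. r k * x k) \<le> (x 0 + suminf e) / \<kappa>" for n
      using bound[of n] \<kappa> by (simp add: pos_le_divide_eq mult.commute)
  qed (use r x in simp)
  have "decseq (\<lambda>n. x n - E n)"
  proof (rule decseq_SucI)
    show "x (Suc n) - E (Suc n) \<le> x n - E n" for n
    proof -
      have "0 \<le> \<kappa> * (r n * x n)" using r(1)[of n] x[of n] \<kappa> by (intro mult_nonneg_nonneg) auto
      then show ?thesis using step'[of n] by (simp add: E_def)
    qed
  qed
  moreover have "- suminf e \<le> x n - E n" for n
    using x[of n] E[of n] by linarith
  ultimately obtain L' where "(\<lambda>n. x n - E n) \<longlonglongrightarrow> L'"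
    using decseq_convergent by blast
  moreover have "E \<longlonglongrightarrow> suminf e"
    unfolding E_def using e(2) by (rule summable_LIMSEQ)
  ultimately have lim: "x \<longlonglongrightarrow> L' + suminf e"
    using tendsto_add by fastforce
  define L where "L = L' + suminf e"
  have "0 \<le> L" using lim x unfolding L_def by (intro LIMSEQ_le_const) auto
  moreover have "\<not> 0 < L"
  proof
    assume L: "0 < L"
    have "eventually (\<lambda>n. L / 2 < x n) sequentially"
      using lim L unfolding L_def by (intro order_tendstoD) auto
    then have "eventually (\<lambda>n. norm (r n) \<le> 2 / L * (r n * x n)) sequentially"
    proof (rule eventually_mono)
      fix n assume "L / 2 < x n"
      then have "1 \<le> 2 / L * x n" using L by (simp add: field_simps)
      from mult_left_mono[OF this r(1)[of n]] show "norm (r n) \<le> 2 / L * (r n * x n)"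
        using r(1)[of n] by (simp add: mult_ac)
    qed
    then have "summable r"
      using summable_mult[OF rx, of "2 / L"] by (rule summable_comparison_test_ev)
    then show False using r(2) by simp
  qed
  ultimately show ?thesis using lim unfolding L_def by simp
qed

text \<open>Such functions are closed under sums and products and integrable for finite measures, so
  integrability is settled by the shape of the expression. Only the sigma-algebra of
  \<open>N\<close> matters, which lets the same predicate express dependence on the past.\<close>

definition bounded_measurable :: "'a measure \<Rightarrow> ('a \<Rightarrow> real) \<Rightarrow> bool" where
  "bounded_measurable N Y \<longleftrightarrow> Y \<in> borel_measurable N \<and> (\<exists>C. \<forall>\<omega>\<in>space N. \<bar>Y \<omega>\<bar> \<le> C)"

named_theorems bounded_measurable_intros

lemma bounded_measurableI:
  assumes "Y \<in> borel_measurable N" "\<And>\<omega>. \<omega> \<in> space N \<Longrightarrow> \<bar>Y \<omega>\<bar> \<le> C"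
  shows "bounded_measurable N Y"
  using assms by (auto simp: bounded_measurable_def)

lemma bounded_measurable_const [bounded_measurable_intros]: "bounded_measurable N (\<lambda>_. c)"
  by (rule bounded_measurableI[of _ _ "\<bar>c\<bar>"]) auto

lemma bounded_measurable_indicator [bounded_measurable_intros]:
  "A \<in> sets N \<Longrightarrow> bounded_measurable N (indicator A)"
  by (rule bounded_measurableI[of _ _ 1]) (auto simp: indicator_def)

lemma bounded_measurable_add [bounded_measurable_intros]:
  assumes "bounded_measurable N Y" "bounded_measurable N Y'"
  shows "bounded_measurable N (\<lambda>\<omega>. Y \<omega> + Y' \<omega>)"
proof -
  obtain C C' where "\<And>\<omega>. \<omega> \<in> space N \<Longrightarrow> \<bar>Y \<omega>\<bar> \<le> C" "\<And>\<omega>. \<omega> \<in> space N \<Longrightarrow> \<bar>Y' \<omega>\<bar> \<le> C'"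
    using assms by (auto simp: bounded_measurable_def)
  then have "\<bar>Y \<omega> + Y' \<omega>\<bar> \<le> C + C'" if "\<omega> \<in> space N" for \<omega>
    using that abs_triangle_ineq[of "Y \<omega>" "Y' \<omega>"] by (meson add_mono order_trans)
  then show ?thesis using assms by (intro bounded_measurableI) (auto simp: bounded_measurable_def)
qed

lemma bounded_measurable_mult [bounded_measurable_intros]:
  assumes "bounded_measurable N Y" "bounded_measurable N Y'"
  shows "bounded_measurable N (\<lambda>\<omega>. Y \<omega> * Y' \<omega>)"
proof -
  obtain C C' where "\<And>\<omega>. \<omega> \<in> space N \<Longrightarrow> \<bar>Y \<omega>\<bar> \<le> C" "\<And>\<omega>. \<omega> \<in> space N \<Longrightarrow> \<bar>Y' \<omega>\<bar> \<le> C'"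
    using assms by (auto simp: bounded_measurable_def)
  then have "\<bar>Y \<omega> * Y' \<omega>\<bar> \<le> C * C'" if "\<omega> \<in> space N" for \<omega>
    using that unfolding abs_mult by (intro mult_mono') auto
  then show ?thesis using assms by (intro bounded_measurableI) (auto simp: bounded_measurable_def)
qed

lemma bounded_measurable_diff [bounded_measurable_intros]:
  assumes "bounded_measurable N Y" "bounded_measurable N Y'"
  shows "bounded_measurable N (\<lambda>\<omega>. Y \<omega> - Y' \<omega>)"
  using bounded_measurable_add[OF assms(1) bounded_measurable_mult[OF bounded_measurable_const[of N "-1"] assms(2)]]
  by simp

lemma bounded_measurable_power2 [bounded_measurable_intros]:
  "bounded_measurable N Y \<Longrightarrow> bounded_measurable N (\<lambda>\<omega>. (Y \<omega>)\<^sup>2)"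
  unfolding power2_eq_square by (rule bounded_measurable_mult)

lemma bounded_measurable_sum [bounded_measurable_intros]:
  "(\<And>i. i \<in> I \<Longrightarrow> bounded_measurable N (Y i)) \<Longrightarrow> bounded_measurable N (\<lambda>\<omega>. \<Sum>i\<in>I. Y i \<omega>)"
  by (induction I rule: infinite_finite_induct) (auto intro!: bounded_measurable_intros)

lemma bounded_measurable_inner [bounded_measurable_intros]:
  fixes f :: "real ^ 'n"
  assumes "\<And>l. bounded_measurable N (\<lambda>\<omega>. Y \<omega> $ l)"
  shows "bounded_measurable N (\<lambda>\<omega>. f \<bullet> Y \<omega>)"
  unfolding inner_vec_def by (auto intro!: bounded_measurable_intros assms)

lemma bounded_measurable_subalgebra:
  "subalgebra M N \<Longrightarrow> bounded_measurable N Y \<Longrightarrow> bounded_measurable M Y"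
  unfolding bounded_measurable_def subalgebra_def
  by (metis measurable_from_subalg subalgebra_def)

lemma (in finite_measure) integrable_bounded_measurable:
  "bounded_measurable M Y \<Longrightarrow> integrable M Y"
  unfolding bounded_measurable_def
  by (elim conjE exE, rule integrable_const_bound[OF AE_I2]) auto

section \<open>The process and integrals against functions of the past\<close>

locale reinforced_process = irreducible_stochastic P + prob_space M
  for P :: "real ^ 'n ^ 'n" and M :: "'a measure" +
  fixes r :: "nat \<Rightarrow> real" and Z X :: "nat \<Rightarrow> 'a \<Rightarrow> real ^ 'n"
  assumes r: "\<And>n. 0 < r n" "\<And>n. r n < 1"
    and Z0_measurable: "Z 0 \<in> borel_measurable M"
    and Z0_range: "\<And>\<omega> l. \<omega> \<in> space M \<Longrightarrow> 0 \<le> Z 0 \<omega> $ l \<and> Z 0 \<omega> $ l \<le> 1"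
    and X_range: "\<And>n \<omega> l. \<omega> \<in> space M \<Longrightarrow> X (Suc n) \<omega> $ l = 0 \<or> X (Suc n) \<omega> $ l = 1"
    and X_cond_indep: "\<And>n. cond_indep_vars M (hist M (Z 0) X n)
      (\<lambda>_. borel) (\<lambda>l \<omega>. X (Suc n) \<omega> $ l) UNIV"
    and X_cond_prob: "\<And>n l. AE \<omega> in M.
      real_cond_exp M (hist M (Z 0) X n) (indicator {\<omega> \<in> space M. X (Suc n) \<omega> $ l = 1}) \<omega>
        = (P *v Z n \<omega>) $ l"
    and Z_Suc: "\<And>n \<omega>. \<omega> \<in> space M \<Longrightarrow>
      Z (Suc n) \<omega> = (1 - r n) *\<^sub>R Z n \<omega> + r n *\<^sub>R X (Suc n) \<omega>"
begin

abbreviation F :: "nat \<Rightarrow> 'a measure" where "F \<equiv> hist M (Z 0) X"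

text \<open>The conditional probability of \<open>X (Suc n) \<omega> $ l = 1\<close> given
  \<open>F n\<close>, in an explicit version that is defined at every outcome.\<close>

definition p :: "nat \<Rightarrow> 'n \<Rightarrow> 'a \<Rightarrow> real" where "p n l \<omega> = (P *v Z n \<omega>) $ l"

lemma p_eq: "p n l \<omega> = (\<Sum>m\<in>UNIV. P $ l $ m * Z n \<omega> $ m)"
  by (simp add: p_def matrix_vector_mult_def)

lemma space_F [simp]: "space (F n) = space M"
  unfolding hist_def by (rule space_measure_of) auto

lemma sets_F: "sets (F n) = sigma_sets (space M)
     ({(\<lambda>\<omega>. Z 0 \<omega> $ l) -` B \<inter> space M | l B. B \<in> sets borel} \<union>
      {(\<lambda>\<omega>. X k \<omega> $ l) -` B \<inter> space M | k l B. 1 \<le> k \<and> k \<le> n \<and> B \<in> sets borel})"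
  unfolding hist_def by (rule sets_measure_of) auto

lemma X_measurable: "(\<lambda>\<omega>. X (Suc n) \<omega> $ l) \<in> borel_measurable M"
  using X_cond_indep unfolding cond_indep_vars_def by blast

lemma Z0_nth_measurable: "(\<lambda>\<omega>. Z 0 \<omega> $ l) \<in> borel_measurable M"
  using measurable_compose[OF Z0_measurable borel_measurable_nth] .

lemma subalgebra_F: "subalgebra M (F n)"
  unfolding subalgebra_def
proof
  show "sets (F n) \<subseteq> sets M"
    unfolding sets_F
  proof (rule sets.sigma_sets_subset, safe)
    fix l and B :: "real set" assume "B \<in> sets borel"
    then show "(\<lambda>\<omega>. Z 0 \<omega> $ l) -` B \<inter> space M \<in> sets M"
      using Z0_nth_measurable by (rule measurable_sets[rotated])
  next
    fix k :: nat and l and B :: "real set" assume "1 \<le> k" "B \<in> sets borel"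
    then show "(\<lambda>\<omega>. X k \<omega> $ l) -` B \<inter> space M \<in> sets M"
      using X_measurable[of "k - 1" l] by (auto intro: measurable_sets)
  qed
qed simp

lemma Z0_F: "(\<lambda>\<omega>. Z 0 \<omega> $ l) \<in> borel_measurable (F n)"
  unfolding measurable_def by (auto simp: sets_F intro!: sigma_sets.Basic)

lemma X_F: "k < n \<Longrightarrow> (\<lambda>\<omega>. X (Suc k) \<omega> $ l) \<in> borel_measurable (F n)"
  unfolding measurable_def
  by (auto simp: sets_F intro!: sigma_sets.Basic UnI2 exI[of _ "Suc k"] exI[of _ l])

lemma Z_F: "k \<le> n \<Longrightarrow> (\<lambda>\<omega>. Z k \<omega> $ l) \<in> borel_measurable (F n)"
proof (induction k)
  case 0
  show ?case by (rule Z0_F)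
next
  case (Suc k)
  have "(\<lambda>\<omega>. (1 - r k) * Z k \<omega> $ l + r k * X (Suc k) \<omega> $ l) \<in> borel_measurable (F n)"
    using Suc X_F[of k n l] by (intro borel_measurable_add borel_measurable_times) auto
  moreover have "(\<lambda>\<omega>. Z (Suc k) \<omega> $ l) \<in> borel_measurable (F n) \<longleftrightarrow>
      (\<lambda>\<omega>. (1 - r k) * Z k \<omega> $ l + r k * X (Suc k) \<omega> $ l) \<in> borel_measurable (F n)"
    by (rule measurable_cong) (simp add: Z_Suc)
  ultimately show ?case by simp
qed

lemma Z_range: "\<omega> \<in> space M \<Longrightarrow> 0 \<le> Z n \<omega> $ l \<and> Z n \<omega> $ l \<le> 1"
proof (induction n)
  case 0
  then show ?case by (rule Z0_range)
next
  case (Suc n)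
  then have z: "0 \<le> Z n \<omega> $ l" "Z n \<omega> $ l \<le> 1" by auto
  have "(1 - r n) * Z n \<omega> $ l \<le> 1 - r n" "0 \<le> (1 - r n) * Z n \<omega> $ l"
    using mult_left_mono[OF z(2), of "1 - r n"] z(1) r[of n] by simp_all
  moreover have "0 \<le> r n * X (Suc n) \<omega> $ l" "r n * X (Suc n) \<omega> $ l \<le> r n"
    using X_range[OF Suc.prems, of n l] r[of n] by auto
  moreover have "Z (Suc n) \<omega> $ l = (1 - r n) * Z n \<omega> $ l + r n * X (Suc n) \<omega> $ l"
    using Suc by (simp add: Z_Suc)
  ultimately show ?case by linarith
qed

lemma p_range: "\<omega> \<in> space M \<Longrightarrow> 0 \<le> p n l \<omega> \<and> p n l \<omega> \<le> 1"
proof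
  assume \<omega>: "\<omega> \<in> space M"
  show "0 \<le> p n l \<omega>"
    unfolding p_eq using Z_range[OF \<omega>] nonneg by (intro sum_nonneg) auto
  have "p n l \<omega> \<le> (\<Sum>m\<in>UNIV. P $ l $ m)"
    unfolding p_eq using Z_range[OF \<omega>] nonneg by (intro sum_mono mult_left_le) auto
  then show "p n l \<omega> \<le> 1" by (simp add: row_sum')
qed

lemma bounded_measurable_Z [bounded_measurable_intros]:
  "k \<le> n \<Longrightarrow> bounded_measurable (F n) (\<lambda>\<omega>. Z k \<omega> $ l)"
  using Z_F Z_range by (intro bounded_measurableI[of _ _ 1]) (auto simp: abs_le_iff intro: order_trans[of _ 0])

lemma bounded_measurable_p [bounded_measurable_intros]:
  "k \<le> n \<Longrightarrow> bounded_measurable (F n) (p k l)"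
  using bounded_measurable_sum[of UNIV "F n" "\<lambda>m \<omega>. P $ l $ m * Z k \<omega> $ m"]
  by (simp add: p_eq[abs_def] bounded_measurable_intros)

lemma bounded_measurable_X: "bounded_measurable M (\<lambda>\<omega>. X (Suc n) \<omega> $ l)"
proof (rule bounded_measurableI[OF X_measurable, of _ _ 1])
  show "\<bar>X (Suc n) \<omega> $ l\<bar> \<le> 1" if "\<omega> \<in> space M" for \<omega>
    using X_range[OF that, of n l] by auto
qed

lemma bounded_measurable_F_imp: "bounded_measurable (F n) Y \<Longrightarrow> bounded_measurable M Y"
  using bounded_measurable_subalgebra[OF subalgebra_F] .

lemmas bounded_measurable_M = bounded_measurable_intros bounded_measurable_X
  bounded_measurable_F_imp[OF bounded_measurable_Z, OF order_refl]
  bounded_measurable_F_imp[OF bounded_measurable_p, OF order_refl]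

lemmas integrable_M = integrable_bounded_measurable bounded_measurable_M

text \<open>The only use of conditional expectations: integrated against a bounded function of the
  past, an almost sure version may be replaced by an explicit one.\<close>

lemma cond_exp_intg:
  assumes Y: "bounded_measurable (F n) Y" and g: "bounded_measurable M g"
    and h: "AE \<omega> in M. real_cond_exp M (F n) g \<omega> = h \<omega>"
    and hm: "h \<in> borel_measurable M"
  shows "(\<integral>\<omega>. Y \<omega> * g \<omega> \<partial>M) = (\<integral>\<omega>. Y \<omega> * h \<omega> \<partial>M)"
proof -
  interpret F: finite_measure_subalgebra M "F n"
    by unfold_locales (rule subalgebra_F)
  have [measurable]: "Y \<in> borel_measurable (F n)" "g \<in> borel_measurable M"
    using Y g by (auto simp: bounded_measurable_def)
  have [measurable]: "Y \<in> borel_measurable M" by (rule measurable_from_subalg[OF subalgebra_F]) measurable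
  have "(\<integral>\<omega>. Y \<omega> * g \<omega> \<partial>M) = (\<integral>\<omega>. Y \<omega> * real_cond_exp M (F n) g \<omega> \<partial>M)"
    using bounded_measurable_mult[OF bounded_measurable_F_imp[OF Y] g]
    by (intro F.real_cond_exp_intg(2)[symmetric] integrable_bounded_measurable) measurable
  also have "\<dots> = (\<integral>\<omega>. Y \<omega> * h \<omega> \<partial>M)"
    using h hm by (intro integral_cong_AE) auto
  finally show ?thesis .
qed

lemma p_measurable: "p n l \<in> borel_measurable M"
  using bounded_measurable_F_imp[OF bounded_measurable_p[OF order_refl]]
  by (simp add: bounded_measurable_def)

lemma integral_X:
  assumes Y: "bounded_measurable (F n) Y"
  shows "(\<integral>\<omega>. Y \<omega> * X (Suc n) \<omega> $ l \<partial>M) = (\<integral>\<omega>. Y \<omega> * p n l \<omega> \<partial>M)"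
proof -
  let ?A = "{\<omega> \<in> space M. X (Suc n) \<omega> $ l = 1}"
  have A: "?A \<in> sets M" using X_measurable by measurable
  have "(\<integral>\<omega>. Y \<omega> * X (Suc n) \<omega> $ l \<partial>M) = (\<integral>\<omega>. Y \<omega> * indicator ?A \<omega> \<partial>M)"
  proof (rule Bochner_Integration.integral_cong[OF refl])
    fix \<omega> assume "\<omega> \<in> space M"
    then show "Y \<omega> * X (Suc n) \<omega> $ l = Y \<omega> * indicator ?A \<omega>"
      using X_range[of \<omega> n l] by auto
  qed
  also have "\<dots> = (\<integral>\<omega>. Y \<omega> * p n l \<omega> \<partial>M)"
    using X_cond_prob[of n l] A unfolding p_def[symmetric]
    by (intro cond_exp_intg[OF Y] bounded_measurable_indicator p_measurable)
  finally show ?thesis .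
qed

lemma integral_X_X:
  assumes Y: "bounded_measurable (F n) Y" and "l \<noteq> m"
  shows "(\<integral>\<omega>. Y \<omega> * (X (Suc n) \<omega> $ l * X (Suc n) \<omega> $ m) \<partial>M) = (\<integral>\<omega>. Y \<omega> * (p n l \<omega> * p n m \<omega>) \<partial>M)"
proof -
  \<comment> \<open>Written with membership in \<open>{1}\<close> so that the product formula of
    \<open>cond_indep_vars\<close> applies to it directly.\<close>
  let ?A = "{\<omega> \<in> space M. \<forall>i\<in>{l, m}. X (Suc n) \<omega> $ i \<in> {1}}"
  have A: "?A \<in> sets M" using X_measurable[of n] by simp
  have "(\<integral>\<omega>. Y \<omega> * (X (Suc n) \<omega> $ l * X (Suc n) \<omega> $ m) \<partial>M) = (\<integral>\<omega>. Y \<omega> * indicator ?A \<omega> \<partial>M)"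
  proof (rule Bochner_Integration.integral_cong[OF refl])
    fix \<omega> assume "\<omega> \<in> space M"
    then show "Y \<omega> * (X (Suc n) \<omega> $ l * X (Suc n) \<omega> $ m) = Y \<omega> * indicator ?A \<omega>"
      using X_range[of \<omega> n l] X_range[of \<omega> n m] by auto
  qed
  also have "\<dots> = (\<integral>\<omega>. Y \<omega> * (p n l \<omega> * p n m \<omega>) \<partial>M)"
  proof (intro cond_exp_intg[OF Y] bounded_measurable_indicator A borel_measurable_times p_measurable)
    have "AE \<omega> in M. real_cond_exp M (F n) (indicator ?A) \<omega> =
      (\<Prod>i\<in>{l, m}. real_cond_exp M (F n) (indicator {\<omega> \<in> space M. X (Suc n) \<omega> $ i \<in> {1}}) \<omega>)"
    proof -
      have "(\<lambda>_. {1}) \<in> {l, m} \<rightarrow> sets (borel :: real measure)" by auto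
      then show ?thesis
        using X_cond_indep[of n] unfolding cond_indep_vars_def
        by (elim conjE allE[of _ "{l, m}"]) (auto elim!: ballE[of _ _ "\<lambda>_. {1}"])
    qed
    then show "AE \<omega> in M. real_cond_exp M (F n) (indicator ?A) \<omega> = p n l \<omega> * p n m \<omega>"
      using X_cond_prob[of n l] X_cond_prob[of n m]
      by eventually_elim (use \<open>l \<noteq> m\<close> in \<open>simp add: p_def\<close>)
  qed
  finally show ?thesis .
qed

section \<open>The noise and its second moments\<close>

definition noise :: "nat \<Rightarrow> 'n \<Rightarrow> 'a \<Rightarrow> real" where
  "noise n l \<omega> = X (Suc n) \<omega> $ l - p n l \<omega>"

lemma bounded_measurable_noise: "bounded_measurable M (noise n l)"
  unfolding noise_def[abs_def] by (intro bounded_measurable_M)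

lemma integral_noise:
  assumes Y: "bounded_measurable (F n) Y"
  shows "(\<integral>\<omega>. Y \<omega> * noise n l \<omega> \<partial>M) = 0"
proof -
  have "(\<integral>\<omega>. Y \<omega> * noise n l \<omega> \<partial>M) = (\<integral>\<omega>. Y \<omega> * X (Suc n) \<omega> $ l - Y \<omega> * p n l \<omega> \<partial>M)"
    by (simp add: noise_def algebra_simps)
  also have "\<dots> = (\<integral>\<omega>. Y \<omega> * X (Suc n) \<omega> $ l \<partial>M) - (\<integral>\<omega>. Y \<omega> * p n l \<omega> \<partial>M)"
    by (intro Bochner_Integration.integral_diff integrable_M bounded_measurable_F_imp[OF Y])
  finally show ?thesis by (simp add: integral_X[OF Y])
qed

text \<open>Off the diagonal this is conditional independence. On the diagonal a
  \<open>{0, 1}\<close>-valued variable equals its square, which leaves the Bernoulli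
  variance.\<close>

lemma integral_noise_noise:
  assumes Y: "bounded_measurable (F n) Y"
  shows "(\<integral>\<omega>. Y \<omega> * (noise n l \<omega> * noise n m \<omega>) \<partial>M) =
    (if l = m then (\<integral>\<omega>. Y \<omega> * (p n l \<omega> * (1 - p n l \<omega>)) \<partial>M) else 0)"
proof -
  note YM = bounded_measurable_F_imp[OF Y]
  have Yp: "bounded_measurable (F n) (\<lambda>\<omega>. Y \<omega> * p n l \<omega>)" for l
    by (intro bounded_measurable_intros Y order_refl)
  have 1: "(\<integral>\<omega>. Y \<omega> * p n m \<omega> * noise n l \<omega> \<partial>M) = 0" for l m
    by (rule integral_noise[OF Yp])
  have "(\<integral>\<omega>. Y \<omega> * (noise n l \<omega> * noise n m \<omega>) \<partial>M) =
     (\<integral>\<omega>. Y \<omega> * (X (Suc n) \<omega> $ l * X (Suc n) \<omega> $ m) - Y \<omega> * (p n l \<omega> * p n m \<omega>)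
       - (Y \<omega> * p n l \<omega> * noise n m \<omega> + Y \<omega> * p n m \<omega> * noise n l \<omega>) \<partial>M)"
    by (rule Bochner_Integration.integral_cong[OF refl]) (simp add: noise_def algebra_simps)
  also have "\<dots> = (\<integral>\<omega>. Y \<omega> * (X (Suc n) \<omega> $ l * X (Suc n) \<omega> $ m) \<partial>M) - (\<integral>\<omega>. Y \<omega> * (p n l \<omega> * p n m \<omega>) \<partial>M)"
    by (simp add: 1 integrable_M YM bounded_measurable_noise)
  also have "\<dots> = (if l = m then (\<integral>\<omega>. Y \<omega> * (p n l \<omega> * (1 - p n l \<omega>)) \<partial>M) else 0)"
  proof (cases "l = m")
    case True
    have "(\<integral>\<omega>. Y \<omega> * (X (Suc n) \<omega> $ l * X (Suc n) \<omega> $ l) \<partial>M) = (\<integral>\<omega>. Y \<omega> * X (Suc n) \<omega> $ l \<partial>M)"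
      by (rule Bochner_Integration.integral_cong[OF refl]) (use X_range[of _ n l] in fastforce)
    also have "\<dots> = (\<integral>\<omega>. Y \<omega> * p n l \<omega> \<partial>M)" by (rule integral_X[OF Y])
    finally show ?thesis
      using True by (simp add: integrable_M YM right_diff_distrib)
  next
    case False
    then show ?thesis using integral_X_X[OF Y False] by simp
  qed
  finally show ?thesis .
qed

text \<open>\<open>Z (Suc n)\<close> is its conditional mean plus \<open>r n\<close> times the
  noise. The mixed term vanishes since the mean depends on the past, and the noise covariance is
  diagonal. The factor \<open>Y\<close> allows restriction to events of the past.\<close>

lemma integral_inner_square:
  assumes Y: "bounded_measurable (F n) Y"
  shows "(\<integral>\<omega>. Y \<omega> * (f \<bullet> Z (Suc n) \<omega>)\<^sup>2 \<partial>M) =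
    (\<integral>\<omega>. Y \<omega> * (f \<bullet> ((1 - r n) *\<^sub>R Z n \<omega> + r n *\<^sub>R (P *v Z n \<omega>)))\<^sup>2 \<partial>M) +
    (r n)\<^sup>2 * (\<Sum>l\<in>UNIV. (f $ l)\<^sup>2 * (\<integral>\<omega>. Y \<omega> * (p n l \<omega> * (1 - p n l \<omega>)) \<partial>M))"
proof -
  define U where "U \<omega> = f \<bullet> ((1 - r n) *\<^sub>R Z n \<omega> + r n *\<^sub>R (P *v Z n \<omega>))" for \<omega>
  have U_eq: "U \<omega> = (\<Sum>l\<in>UNIV. f $ l * ((1 - r n) * Z n \<omega> $ l + r n * p n l \<omega>))" for \<omega>
    by (simp add: U_def inner_vec_def p_def)
  have U: "bounded_measurable (F n) U"
    unfolding U_eq[abs_def] by (intro bounded_measurable_intros order_refl)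
  have YU: "bounded_measurable (F n) (\<lambda>\<omega>. Y \<omega> * U \<omega>)" by (intro bounded_measurable_intros Y U)
  note [simp] = integrable_M bounded_measurable_F_imp[OF Y] bounded_measurable_F_imp[OF U] bounded_measurable_noise
  have decomp: "f \<bullet> Z (Suc n) \<omega> = U \<omega> + r n * (\<Sum>l\<in>UNIV. f $ l * noise n l \<omega>)" if "\<omega> \<in> space M" for \<omega>
    using that by (simp add: Z_Suc U_eq inner_vec_def noise_def sum_distrib_left algebra_simps flip: sum.distrib)
  have "(\<integral>\<omega>. Y \<omega> * (f \<bullet> Z (Suc n) \<omega>)\<^sup>2 \<partial>M) = (\<integral>\<omega>. Y \<omega> * (U \<omega>)\<^sup>2
      + (\<Sum>l\<in>UNIV. (2 * r n * f $ l) * (Y \<omega> * U \<omega> * noise n l \<omega>))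
      + (\<Sum>l\<in>UNIV. \<Sum>m\<in>UNIV. ((r n)\<^sup>2 * f $ l * f $ m) * (Y \<omega> * (noise n l \<omega> * noise n m \<omega>))) \<partial>M)"
  proof (rule Bochner_Integration.integral_cong[OF refl])
    fix \<omega> assume \<omega>: "\<omega> \<in> space M"
    define N where "N = (\<Sum>l\<in>UNIV. f $ l * noise n l \<omega>)"
    have "N * N = (\<Sum>l\<in>UNIV. \<Sum>m\<in>UNIV. f $ l * noise n l \<omega> * (f $ m * noise n m \<omega>))"
      unfolding N_def by (rule sum_product)
    then have NN: "(\<Sum>l\<in>UNIV. \<Sum>m\<in>UNIV. ((r n)\<^sup>2 * f $ l * f $ m) * (Y \<omega> * (noise n l \<omega> * noise n m \<omega>)))
        = (r n)\<^sup>2 * Y \<omega> * (N * N)"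
      by (simp add: sum_distrib_left mult_ac)
    have N: "(\<Sum>l\<in>UNIV. (2 * r n * f $ l) * (Y \<omega> * U \<omega> * noise n l \<omega>)) = 2 * r n * Y \<omega> * U \<omega> * N"
      unfolding N_def by (simp add: sum_distrib_left mult_ac)
    show "Y \<omega> * (f \<bullet> Z (Suc n) \<omega>)\<^sup>2 = Y \<omega> * (U \<omega>)\<^sup>2
      + (\<Sum>l\<in>UNIV. (2 * r n * f $ l) * (Y \<omega> * U \<omega> * noise n l \<omega>))
      + (\<Sum>l\<in>UNIV. \<Sum>m\<in>UNIV. ((r n)\<^sup>2 * f $ l * f $ m) * (Y \<omega> * (noise n l \<omega> * noise n m \<omega>)))"
      unfolding decomp[OF \<omega>] N_def[symmetric] NN N by (simp add: power2_eq_square algebra_simps)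
  qed
  also have "\<dots> = (\<integral>\<omega>. Y \<omega> * (U \<omega>)\<^sup>2 \<partial>M)
      + (\<Sum>l\<in>UNIV. (2 * r n * f $ l) * (\<integral>\<omega>. Y \<omega> * U \<omega> * noise n l \<omega> \<partial>M))
      + (\<Sum>l\<in>UNIV. \<Sum>m\<in>UNIV. ((r n)\<^sup>2 * f $ l * f $ m) * (\<integral>\<omega>. Y \<omega> * (noise n l \<omega> * noise n m \<omega>) \<partial>M))"
    by (simp add: Bochner_Integration.integral_sum)
  also have "\<dots> = (\<integral>\<omega>. Y \<omega> * (U \<omega>)\<^sup>2 \<partial>M)
      + (\<Sum>l\<in>UNIV. ((r n)\<^sup>2 * f $ l * f $ l) * (\<integral>\<omega>. Y \<omega> * (p n l \<omega> * (1 - p n l \<omega>)) \<partial>M))"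
    by (simp add: integral_noise[OF YU] integral_noise_noise[OF Y] if_distrib cong: if_cong)
  finally show ?thesis
    unfolding U_def by (simp add: sum_distrib_left power2_eq_square mult.assoc)
qed

text \<open>The expected squared length of the random part of step \<open>n\<close>.\<close>

definition noise_var :: "nat \<Rightarrow> real" where
  "noise_var n = (r n)\<^sup>2 * (\<Sum>l\<in>UNIV. (\<integral>\<omega>. p n l \<omega> * (1 - p n l \<omega>) \<partial>M))"

lemma integral_p_var_nonneg: "0 \<le> (\<integral>\<omega>. p n l \<omega> * (1 - p n l \<omega>) \<partial>M)"
  using p_range by (intro integral_nonneg_AE AE_I2) simp

lemma noise_var_nonneg: "0 \<le> noise_var n"
  unfolding noise_var_def by (intro mult_nonneg_nonneg sum_nonneg integral_p_var_nonneg) simp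

text \<open>
  The average of \<open>Z n\<close> with respect to the stationary vector is a bounded martingale, hence the
  variances of its increments are summable.
\<close>

lemma summable_noise_var: "summable noise_var"
proof -
  obtain v where v: "\<And>i. 0 < v i" and stat: "\<And>j. (\<Sum>i\<in>UNIV. v i * P $ i $ j) = v j"
    using stationary_exists by blast
  define f :: "real ^ 'n" where "f = (\<chi> i. v i)"
  \<comment> \<open>The martingale property: the drift leaves the stationary average
    unchanged.\<close>
  have fP: "f \<bullet> (P *v z) = f \<bullet> z" for z
  proof -
    have "f \<bullet> (P *v z) = (\<Sum>j\<in>UNIV. (\<Sum>i\<in>UNIV. v i * P $ i $ j) * z $ j)"
      unfolding sum_distrib_right
      by (subst sum.swap) (simp add: inner_vec_def f_def matrix_vector_mult_def sum_distrib_left mult.assoc)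
    then show ?thesis by (simp add: stat inner_vec_def f_def)
  qed
  define E where "E n = (\<integral>\<omega>. (f \<bullet> Z n \<omega>)\<^sup>2 \<partial>M)" for n
  \<comment> \<open>Since all stationary weights are positive, the martingale sees the variance of
    each coordinate with at least this factor.\<close>
  define c where "c = Min (range (\<lambda>i. (v i)\<^sup>2))"
  have c: "0 < c" "\<And>i. c \<le> (v i)\<^sup>2"
    unfolding c_def using v[THEN less_imp_neq] by (auto simp: Min_gr_iff)
  have step: "E n + c * noise_var n \<le> E (Suc n)" for n
  proof -
    have "E (Suc n) = E n + (r n)\<^sup>2 * (\<Sum>l\<in>UNIV. (v l)\<^sup>2 * (\<integral>\<omega>. p n l \<omega> * (1 - p n l \<omega>) \<partial>M))"
    proof -
      have "f \<bullet> ((1 - r n) *\<^sub>R z + r n *\<^sub>R (P *v z)) = f \<bullet> z" for z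
        by (simp add: inner_add_right fP left_diff_distrib)
      then show ?thesis
        unfolding E_def using integral_inner_square[OF bounded_measurable_const[of "F n" 1], of f]
        by (simp add: f_def)
    qed
    moreover have "c * (\<Sum>l\<in>UNIV. (\<integral>\<omega>. p n l \<omega> * (1 - p n l \<omega>) \<partial>M)) \<le>
       (\<Sum>l\<in>UNIV. (v l)\<^sup>2 * (\<integral>\<omega>. p n l \<omega> * (1 - p n l \<omega>) \<partial>M))"
      unfolding sum_distrib_left by (intro sum_mono mult_right_mono c integral_p_var_nonneg)
    from mult_left_mono[OF this, of "(r n)\<^sup>2"]
    have "c * noise_var n \<le> (r n)\<^sup>2 * (\<Sum>l\<in>UNIV. (v l)\<^sup>2 * (\<integral>\<omega>. p n l \<omega> * (1 - p n l \<omega>) \<partial>M))"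
      by (simp add: noise_var_def mult.left_commute)
    ultimately show ?thesis by simp
  qed
  have E_le: "E n \<le> (\<Sum>i\<in>UNIV. v i)\<^sup>2" for n
  proof -
    have b: "(f \<bullet> Z n \<omega>)\<^sup>2 \<le> (\<Sum>i\<in>UNIV. v i)\<^sup>2" if "\<omega> \<in> space M" for \<omega>
    proof (rule power_mono)
      show "f \<bullet> Z n \<omega> \<le> (\<Sum>i\<in>UNIV. v i)"
        unfolding inner_vec_def f_def using Z_range[OF that] v
        by (intro sum_mono) (simp add: mult_left_le less_imp_le)
      show "0 \<le> f \<bullet> Z n \<omega>"
        unfolding inner_vec_def f_def using Z_range[OF that] v
        by (intro sum_nonneg) (simp add: less_imp_le)
    qed
    have "E n \<le> (\<integral>\<omega>. (\<Sum>i\<in>UNIV. v i)\<^sup>2 \<partial>M)"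
      unfolding E_def by (intro integral_mono integrable_M b)
    then show ?thesis by (simp add: prob_space)
  qed
  have "E 0 + c * (\<Sum>k<n. noise_var k) \<le> E n" for n
  proof (induction n)
    case (Suc n)
    then show ?case using step[of n] by (simp add: distrib_left)
  qed simp
  moreover have "0 \<le> E 0" unfolding E_def by simp
  ultimately have "c * (\<Sum>k<n. noise_var k) \<le> (\<Sum>i\<in>UNIV. v i)\<^sup>2" for n
    using E_le[of n] by (smt (verit))
  then have "(\<Sum>k<n. noise_var k) \<le> (\<Sum>i\<in>UNIV. v i)\<^sup>2 / c" for n
    using c(1) by (simp add: pos_le_divide_eq mult.commute)
  then show ?thesis using noise_var_nonneg by (intro summableI_nonneg_bounded)
qed


section \<open>The supermartingale argument for an arbitrary contracted form\<close>

context
  fixes T :: "'t set" and w :: "'t \<Rightarrow> real" and f :: "'t \<Rightarrow> real ^ 'n" and \<kappa> :: real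
  assumes w: "\<And>t. t \<in> T \<Longrightarrow> 0 \<le> w t" and \<kappa>: "0 < \<kappa>"
    and contracting: "\<And>z r. 0 \<le> r \<Longrightarrow> r \<le> 1 \<Longrightarrow>
       quad_form T w f ((1 - r) *\<^sub>R z + r *\<^sub>R (P *v z)) \<le> (1 - \<kappa> * r) * quad_form T w f z"
begin

abbreviation Q :: "real ^ 'n \<Rightarrow> real" where "Q \<equiv> quad_form T w f"

lemma Q_nonneg: "0 \<le> Q z"
  unfolding quad_form_def using w by (intro sum_nonneg) auto

lemma bounded_measurable_Q [bounded_measurable_intros]:
  "k \<le> n \<Longrightarrow> bounded_measurable (F n) (\<lambda>\<omega>. Q (Z k \<omega>))"
  unfolding quad_form_def by (intro bounded_measurable_intros)

text \<open>Each coordinate variance is bounded by the total over all coordinates, so a fixed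
  multiple of \<open>noise_var\<close> dominates the noise in all functionals.\<close>

definition Q_err :: "nat \<Rightarrow> real" where
  "Q_err n = (\<Sum>t\<in>T. \<Sum>l\<in>UNIV. w t * (f t $ l)\<^sup>2) * noise_var n"

lemma Q_err: "0 \<le> Q_err n" "summable Q_err"
  unfolding Q_err_def[abs_def] using w
  by (auto intro!: mult_nonneg_nonneg sum_nonneg noise_var_nonneg summable_mult summable_noise_var)

text \<open>The supermartingale inequality, integrated over an event of the past. The whole space
  for \<open>B\<close> gives the recursion of the expectations, the events \<open>below\<close> give
  the maximal inequality.\<close>

lemma integral_Q_Suc_le:
  assumes B: "B \<in> sets (F n)"
  shows "(\<integral>\<omega>. indicator B \<omega> * Q (Z (Suc n) \<omega>) \<partial>M) \<le>
    (1 - \<kappa> * r n) * (\<integral>\<omega>. indicator B \<omega> * Q (Z n \<omega>) \<partial>M) + Q_err n"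
proof -
  let ?A = "\<lambda>\<omega>. (1 - r n) *\<^sub>R Z n \<omega> + r n *\<^sub>R (P *v Z n \<omega>)"
  note iB = bounded_measurable_indicator[OF B]
  note [simp] = integrable_M bounded_measurable_F_imp[OF iB]
    bounded_measurable_F_imp[OF bounded_measurable_Z] bounded_measurable_F_imp[OF bounded_measurable_Q]
  have A: "bounded_measurable M (\<lambda>\<omega>. ?A \<omega> $ l)" for l
    by (simp add: p_def[symmetric])
  have "(\<integral>\<omega>. indicator B \<omega> * Q (Z (Suc n) \<omega>) \<partial>M) =
      (\<Sum>t\<in>T. w t * (\<integral>\<omega>. indicator B \<omega> * (f t \<bullet> Z (Suc n) \<omega>)\<^sup>2 \<partial>M))"
  proof -
    have "(\<integral>\<omega>. indicator B \<omega> * Q (Z (Suc n) \<omega>) \<partial>M) =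
        (\<integral>\<omega>. (\<Sum>t\<in>T. w t * (indicator B \<omega> * (f t \<bullet> Z (Suc n) \<omega>)\<^sup>2)) \<partial>M)"
      by (simp add: quad_form_def sum_distrib_left mult.left_commute)
    also have "\<dots> = (\<Sum>t\<in>T. w t * (\<integral>\<omega>. indicator B \<omega> * (f t \<bullet> Z (Suc n) \<omega>)\<^sup>2 \<partial>M))"
      by (simp add: Bochner_Integration.integral_sum)
    finally show ?thesis .
  qed
  also have "\<dots> = (\<Sum>t\<in>T. w t * (\<integral>\<omega>. indicator B \<omega> * (f t \<bullet> ?A \<omega>)\<^sup>2 \<partial>M)) +
      (\<Sum>t\<in>T. \<Sum>l\<in>UNIV. w t * (f t $ l)\<^sup>2 * ((r n)\<^sup>2 * (\<integral>\<omega>. indicator B \<omega> * (p n l \<omega> * (1 - p n l \<omega>)) \<partial>M)))"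
    unfolding integral_inner_square[OF iB] by (simp add: distrib_left sum.distrib sum_distrib_left mult_ac)
  also have "(\<Sum>t\<in>T. w t * (\<integral>\<omega>. indicator B \<omega> * (f t \<bullet> ?A \<omega>)\<^sup>2 \<partial>M)) =
      (\<integral>\<omega>. indicator B \<omega> * Q (?A \<omega>) \<partial>M)"
  proof -
    have "(\<integral>\<omega>. indicator B \<omega> * Q (?A \<omega>) \<partial>M) =
        (\<integral>\<omega>. (\<Sum>t\<in>T. w t * (indicator B \<omega> * (f t \<bullet> ?A \<omega>)\<^sup>2)) \<partial>M)"
      by (simp add: quad_form_def sum_distrib_left mult.left_commute)
    also have "\<dots> = (\<Sum>t\<in>T. w t * (\<integral>\<omega>. indicator B \<omega> * (f t \<bullet> ?A \<omega>)\<^sup>2 \<partial>M))"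
      by (subst Bochner_Integration.integral_sum)
         (intro integrable_bounded_measurable bounded_measurable_intros bounded_measurable_F_imp[OF iB] A, simp)
    finally show ?thesis by simp
  qed
  also have "\<dots> \<le> (\<integral>\<omega>. indicator B \<omega> * ((1 - \<kappa> * r n) * Q (Z n \<omega>)) \<partial>M)"
  proof (rule integral_mono)
    show "integrable M (\<lambda>\<omega>. indicator B \<omega> * Q (?A \<omega>))"
      unfolding quad_form_def
      by (intro integrable_bounded_measurable bounded_measurable_intros bounded_measurable_F_imp[OF iB] A)
    show "indicator B \<omega> * Q (?A \<omega>) \<le> indicator B \<omega> * ((1 - \<kappa> * r n) * Q (Z n \<omega>))" for \<omega>
      using r[of n] by (intro mult_left_mono contracting) auto
    show "integrable M (\<lambda>\<omega>. indicator B \<omega> * ((1 - \<kappa> * r n) * Q (Z n \<omega>)))"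
      by (intro integrable_bounded_measurable bounded_measurable_intros
        bounded_measurable_F_imp[OF iB] bounded_measurable_F_imp[OF bounded_measurable_Q[OF order_refl]])
  qed
  also have "\<dots> = (1 - \<kappa> * r n) * (\<integral>\<omega>. indicator B \<omega> * Q (Z n \<omega>) \<partial>M)"
    by (simp add: mult.left_commute[of _ "1 - \<kappa> * r n"])
  also have "(\<Sum>t\<in>T. \<Sum>l\<in>UNIV. w t * (f t $ l)\<^sup>2 *
      ((r n)\<^sup>2 * (\<integral>\<omega>. indicator B \<omega> * (p n l \<omega> * (1 - p n l \<omega>)) \<partial>M))) \<le>
      (\<Sum>t\<in>T. \<Sum>l\<in>UNIV. w t * (f t $ l)\<^sup>2 * noise_var n)"
  proof (intro sum_mono mult_left_mono)
    fix t l assume "t \<in> T"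
    then show "0 \<le> w t * (f t $ l)\<^sup>2" using w by simp
    have "(\<integral>\<omega>. indicator B \<omega> * (p n l \<omega> * (1 - p n l \<omega>)) \<partial>M) \<le> (\<integral>\<omega>. p n l \<omega> * (1 - p n l \<omega>) \<partial>M)"
      by (rule integral_mono, simp, simp) (use p_range in \<open>auto simp: indicator_def\<close>)
    also have "\<dots> \<le> (\<Sum>l\<in>UNIV. (\<integral>\<omega>. p n l \<omega> * (1 - p n l \<omega>) \<partial>M))"
      by (intro member_le_sum integral_p_var_nonneg) auto
    finally show "(r n)\<^sup>2 * (\<integral>\<omega>. indicator B \<omega> * (p n l \<omega> * (1 - p n l \<omega>)) \<partial>M) \<le> noise_var n"
      unfolding noise_var_def by (intro mult_left_mono) auto
  qed
  also have "\<dots> = Q_err n" by (simp add: Q_err_def sum_distrib_right)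
  finally show ?thesis by simp
qed

lemma integral_Q_Suc_le':
  assumes B: "B \<in> sets (F n)"
  shows "(\<integral>\<omega>. indicator B \<omega> * Q (Z (Suc n) \<omega>) \<partial>M) \<le> (\<integral>\<omega>. indicator B \<omega> * Q (Z n \<omega>) \<partial>M) + Q_err n"
proof -
  have "0 \<le> (\<integral>\<omega>. indicator B \<omega> * Q (Z n \<omega>) \<partial>M)"
    by (intro integral_nonneg_AE AE_I2) (simp add: Q_nonneg)
  then have "0 \<le> \<kappa> * r n * (\<integral>\<omega>. indicator B \<omega> * Q (Z n \<omega>) \<partial>M)"
    using \<kappa> r(1)[of n] by simp
  then show ?thesis using integral_Q_Suc_le[OF B] by (simp add: algebra_simps)
qed

text \<open>The event that the first time from \<open>n\<close> on at which the form reaches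
  \<epsilon> is later than \<open>k\<close>.\<close>

definition below :: "real \<Rightarrow> nat \<Rightarrow> nat \<Rightarrow> 'a set" where
  "below \<epsilon> n k = {\<omega> \<in> space M. \<forall>j\<in>{n..k}. Q (Z j \<omega>) < \<epsilon>}"

lemma below_sets: "below \<epsilon> n k \<in> sets (F k)"
proof -
  have "{\<omega> \<in> space (F k). \<forall>j\<in>{n..k}. Q (Z j \<omega>) < \<epsilon>} \<in> sets (F k)"
  proof (rule sets.sets_Collect_finite_All)
    fix j assume "j \<in> {n..k}"
    then have "(\<lambda>\<omega>. Q (Z j \<omega>)) \<in> borel_measurable (F k)"
      using bounded_measurable_Q[of j k] by (simp add: bounded_measurable_def)
    then show "{\<omega> \<in> space (F k). Q (Z j \<omega>) < \<epsilon>} \<in> sets (F k)" by measurable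
  qed simp
  then show ?thesis by (simp add: below_def)
qed

lemma below_events: "below \<epsilon> n k \<in> events"
  using below_sets subalgebra_F unfolding subalgebra_def by blast

text \<open>
  The maximal inequality for supermartingales, for a process which is a supermartingale up to a
  summable error: what is lost by leaving \<open>below\<close> is compensated by \<open>\<epsilon>\<close> times the
  probability of having left it.
\<close>

lemma prob_below:
  assumes \<epsilon>: "0 < \<epsilon>" and "n \<le> k"
  shows "\<epsilon> * (1 - prob (below \<epsilon> n k)) \<le> (\<integral>\<omega>. Q (Z n \<omega>) \<partial>M) + (\<Sum>j=n..<k. Q_err j)"
proof -
  note [simp] = integrable_M bounded_measurable_F_imp[OF bounded_measurable_Q, OF order_refl] below_events
  have "(\<integral>\<omega>. indicator (below \<epsilon> n k) \<omega> * Q (Z k \<omega>) \<partial>M) + \<epsilon> * (1 - prob (below \<epsilon> n k))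
      \<le> (\<integral>\<omega>. Q (Z n \<omega>) \<partial>M) + (\<Sum>j=n..<k. Q_err j)"
    using \<open>n \<le> k\<close>
  proof (induction k rule: dec_induct)
    case base
    have "(\<integral>\<omega>. indicator (below \<epsilon> n n) \<omega> * Q (Z n \<omega>) + \<epsilon> * (1 - indicator (below \<epsilon> n n) \<omega>) \<partial>M)
        \<le> (\<integral>\<omega>. Q (Z n \<omega>) \<partial>M)"
      by (rule integral_mono) (simp, simp, auto simp: below_def indicator_def)
    then show ?case by (simp add: prob_space)
  next
    case (step k)
    let ?B = "below \<epsilon> n k" and ?B' = "below \<epsilon> n (Suc k)"
    \<comment> \<open>At outcomes in \<open>?B\<close> but not in \<open>?B'\<close> the form is at
      least \<epsilon> at time \<open>Suc k\<close>.\<close>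
    have "(\<integral>\<omega>. indicator ?B' \<omega> * Q (Z (Suc k) \<omega>) + \<epsilon> * (indicator ?B \<omega> - indicator ?B' \<omega>) \<partial>M)
       \<le> (\<integral>\<omega>. indicator ?B \<omega> * Q (Z (Suc k) \<omega>) \<partial>M)"
      by (rule integral_mono, simp, simp)
         (use step.hyps in \<open>auto simp: below_def indicator_def Q_nonneg atLeastAtMostSuc_conv\<close>)
    also have "\<dots> \<le> (\<integral>\<omega>. indicator ?B \<omega> * Q (Z k \<omega>) \<partial>M) + Q_err k"
      by (rule integral_Q_Suc_le'[OF below_sets])
    finally have "(\<integral>\<omega>. indicator ?B' \<omega> * Q (Z (Suc k) \<omega>) \<partial>M) + \<epsilon> * (prob ?B - prob ?B') \<le> \<dots>"
      by simp
    then show ?case using step by (simp add: algebra_simps)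
  qed
  moreover have "0 \<le> (\<integral>\<omega>. indicator (below \<epsilon> n k) \<omega> * Q (Z k \<omega>) \<partial>M)"
    by (intro integral_nonneg_AE AE_I2) (simp add: Q_nonneg)
  ultimately show ?thesis by linarith
qed

lemma Q_tendsto_0:
  assumes div: "\<not> summable r"
  shows "AE \<omega> in M. (\<lambda>n. Q (Z n \<omega>)) \<longlonglongrightarrow> 0"
proof -
  define x where "x n = (\<integral>\<omega>. Q (Z n \<omega>) \<partial>M)" for n
  define e where "e n = suminf Q_err - (\<Sum>k<n. Q_err k)" for n
  have "x \<longlonglongrightarrow> 0"
  proof (rule contracting_sequence_tendsto_0[OF _ Q_err _ div \<kappa>])
    show "0 \<le> x n" for n
      unfolding x_def by (intro integral_nonneg_AE AE_I2) (simp add: Q_nonneg)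
    show "0 \<le> r n" for n using r(1)[of n] by simp
    show "x (Suc n) \<le> (1 - \<kappa> * r n) * x n + Q_err n" for n
    proof -
      have "space M \<in> sets (F n)" using sets.top[of "F n"] by simp
      from integral_Q_Suc_le[OF this] show ?thesis
        unfolding x_def by (simp cong: Bochner_Integration.integral_cong)
    qed
  qed
  moreover have "e \<longlonglongrightarrow> 0"
  proof -
    have "(\<lambda>n. suminf Q_err - (\<Sum>k<n. Q_err k)) \<longlonglongrightarrow> suminf Q_err - suminf Q_err"
      by (intro tendsto_diff tendsto_const summable_LIMSEQ Q_err)
    then show ?thesis by (simp add: e_def[abs_def])
  qed
  ultimately have xe: "(\<lambda>n. x n + e n) \<longlonglongrightarrow> 0"
    using tendsto_add[of x 0 sequentially e 0] by simp
  have ev: "AE \<omega> in M. \<exists>n. \<forall>j\<ge>n. Q (Z j \<omega>) < \<epsilon>" if \<epsilon>: "0 < \<epsilon>" for \<epsilon>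
  proof -
    \<comment> \<open>The maximal inequality is restarted at every \<open>n\<close>. Its bound
      involves \<open>x n\<close> and the tail \<open>e n\<close> of the errors, which both tend to
      0, so the union of the \<open>G n\<close> has full probability.\<close>
    define G where "G n = (\<Inter>k. below \<epsilon> n (n + k))" for n
    have G: "G n \<in> events" for n unfolding G_def using below_events by blast
    have probG: "1 - (x n + e n) / \<epsilon> \<le> prob (G n)" for n
    proof (rule LIMSEQ_le_const)
      show "(\<lambda>k. prob (below \<epsilon> n (n + k))) \<longlonglongrightarrow> prob (G n)"
        unfolding G_def
        by (rule finite_Lim_measure_decseq) (use below_events in blast, auto simp: decseq_def below_def)
      have "1 - (x n + e n) / \<epsilon> \<le> prob (below \<epsilon> n (n + k))" for k
      proof -
        have "(\<Sum>j=n..<n + k. Q_err j) = (\<Sum>j<n + k. Q_err j) - (\<Sum>j<n. Q_err j)"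
          using sum_diff_nat_ivl[of 0 n "n + k" Q_err] by (simp add: atLeast0LessThan)
        also have "\<dots> \<le> e n"
          unfolding e_def using sum_le_suminf[OF Q_err(2), of "{..<n + k}"] Q_err(1) by simp
        finally have "\<epsilon> * (1 - prob (below \<epsilon> n (n + k))) \<le> x n + e n"
          using prob_below[OF \<epsilon>, of n "n + k"] by (simp add: x_def)
        then have "1 - prob (below \<epsilon> n (n + k)) \<le> (x n + e n) / \<epsilon>"
          using \<epsilon> by (simp add: pos_le_divide_eq mult.commute)
        then show ?thesis by simp
      qed
      then show "\<exists>N. \<forall>k\<ge>N. 1 - (x n + e n) / \<epsilon> \<le> prob (below \<epsilon> n (n + k))" by blast
    qed
    have "prob (\<Union>n. G n) = 1"
    proof (rule antisym)
      have "(\<lambda>n. 1 - (x n + e n) / \<epsilon>) \<longlonglongrightarrow> 1 - 0 / \<epsilon>"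
        using \<epsilon> by (intro tendsto_diff tendsto_const tendsto_divide xe) auto
      moreover have "1 - (x n + e n) / \<epsilon> \<le> prob (\<Union>n. G n)" for n
        using probG[of n] finite_measure_mono[of "G n" "\<Union>n. G n"] G by (force intro: order_trans)
      ultimately show "1 \<le> prob (\<Union>n. G n)" by (intro LIMSEQ_le_const2) auto
    qed simp
    then have "AE \<omega> in M. \<omega> \<in> (\<Union>n. G n)"
      using G by (subst prob_eq_1[symmetric]) auto
    then show ?thesis
    proof eventually_elim
      fix \<omega> assume "\<omega> \<in> (\<Union>n. G n)"
      then obtain n where n: "\<And>k. \<omega> \<in> below \<epsilon> n (n + k)" by (auto simp: G_def)
      have "Q (Z j \<omega>) < \<epsilon>" if "j \<ge> n" for j
        using n[of "j - n"] that by (simp add: below_def)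
      then show "\<exists>n. \<forall>j\<ge>n. Q (Z j \<omega>) < \<epsilon>" by blast
    qed
  qed
  \<comment> \<open>Countably many thresholds, so that the exceptional null sets can be
    united.\<close>
  have "AE \<omega> in M. \<forall>m::nat. \<exists>n. \<forall>j\<ge>n. Q (Z j \<omega>) < inverse (real (Suc m))"
    unfolding AE_all_countable by (intro allI ev) simp
  then show ?thesis
  proof eventually_elim
    fix \<omega> assume *: "\<forall>m::nat. \<exists>n. \<forall>j\<ge>n. Q (Z j \<omega>) < inverse (real (Suc m))"
    show "(\<lambda>n. Q (Z n \<omega>)) \<longlonglongrightarrow> 0"
    proof (rule LIMSEQ_I)
      fix \<epsilon> :: real assume "0 < \<epsilon>"
      then obtain m where m: "inverse (real (Suc m)) < \<epsilon>" using reals_Archimedean by blast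
      obtain n where "\<forall>j\<ge>n. Q (Z j \<omega>) < inverse (real (Suc m))" using * by blast
      then have "\<forall>j\<ge>n. norm (Q (Z j \<omega>) - 0) < \<epsilon>"
        using m Q_nonneg by (auto intro: less_trans)
      then show "\<exists>n. \<forall>j\<ge>n. norm (Q (Z j \<omega>) - 0) < \<epsilon>" by blast
    qed
  qed
qed

end

theorem synchronization:
  assumes div: "\<not> summable r" and "same_cyclic_class P i j"
  shows "AE \<omega> in M. (\<lambda>n. Z n \<omega> $ j - Z n \<omega> $ i) \<longlonglongrightarrow> 0"
proof (rule contracting_form_exists)
  fix T :: "(nat \<times> 'n \<times> 'n) set" and w \<kappa> and c :: real and f
  assume T: "\<And>t. t \<in> T \<Longrightarrow> 0 \<le> w t" "0 < \<kappa>" and c: "0 < c"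
    and contr: "\<And>z r. 0 \<le> r \<Longrightarrow> r \<le> 1 \<Longrightarrow>
       quad_form T w f ((1 - r) *\<^sub>R z + r *\<^sub>R (P *v z)) \<le> (1 - \<kappa> * r) * quad_form T w f z"
    and dom: "\<And>z i j. same_cyclic_class P i j \<Longrightarrow> c * (z $ i - z $ j)\<^sup>2 \<le> quad_form T w f z"
  have "AE \<omega> in M. (\<lambda>n. quad_form T w f (Z n \<omega>)) \<longlonglongrightarrow> 0"
    by (rule Q_tendsto_0[OF T contr div])
  then show ?thesis
  proof eventually_elim
    fix \<omega> assume "(\<lambda>n. quad_form T w f (Z n \<omega>)) \<longlonglongrightarrow> 0"
    then have lim: "(\<lambda>n. quad_form T w f (Z n \<omega>) / c) \<longlonglongrightarrow> 0"
      by (rule tendsto_divide_zero)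
    have le: "norm ((Z n \<omega> $ j - Z n \<omega> $ i)\<^sup>2) \<le> quad_form T w f (Z n \<omega>) / c" for n
      using dom[OF assms(2), of "Z n \<omega>"] c
      by (simp add: pos_le_divide_eq mult.commute power2_commute)
    have "(\<lambda>n. (Z n \<omega> $ j - Z n \<omega> $ i)\<^sup>2) \<longlonglongrightarrow> 0"
      by (rule Lim_null_comparison[OF always_eventually lim]) (use le in blast)
    then show "(\<lambda>n. Z n \<omega> $ j - Z n \<omega> $ i) \<longlonglongrightarrow> 0"
      by (simp add: power_tendsto_0_iff)
  qed
qed

end

section \<open>Failure of synchronization for summable step sizes\<close>

lemma filterlim_sum_at_top_iff:
  fixes r :: "nat \<Rightarrow> real"
  assumes r: "\<And>n. 0 \<le> r n"
  shows "filterlim (\<lambda>n. \<Sum>k<n. r k) at_top sequentially \<longleftrightarrow> \<not> summable r"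
proof
  assume "filterlim (\<lambda>n. \<Sum>k<n. r k) at_top sequentially"
  then obtain n where n: "suminf r + 1 \<le> (\<Sum>k<n. r k)"
    unfolding filterlim_at_top by (metis eventually_sequentially order_refl)
  show "\<not> summable r"
    using sum_le_suminf[of r "{..<n}"] r n by auto
next
  assume div: "\<not> summable r"
  show "filterlim (\<lambda>n. \<Sum>k<n. r k) at_top sequentially"
    unfolding filterlim_at_top
  proof
    fix C
    obtain n where n: "C < (\<Sum>k<n. r k)"
      using div summableI_nonneg_bounded[of r C] r by (meson not_less)
    have "C \<le> (\<Sum>k<m. r k)" if "n \<le> m" for m
      using n sum_mono2[of "{..<m}" "{..<n}" r] that r by force
    then show "eventually (\<lambda>m. C \<le> (\<Sum>k<m. r k)) sequentially"
      by (auto simp: eventually_sequentially)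
  qed
qed

text \<open>Pigeonhole: the classes are numbered by exactly \<open>matrix_period P\<close> values,
  so an injective numbering would make the period equal to the number of indices.\<close>

lemma (in irreducible_stochastic) same_cyclic_class_distinct:
  assumes "matrix_period P \<noteq> CARD('n)"
  obtains i j where "i \<noteq> j" "same_cyclic_class P i j"
proof -
  obtain c :: "'n \<Rightarrow> nat" where c: "range c = {..<matrix_period P}"
       "\<And>i j. c i = c j \<longleftrightarrow> same_cyclic_class P i j"
    using cyclic_classes_exist[OF nonneg irr] by blast
  have "\<not> inj c"
  proof
    assume "inj c"
    then have "card (range c) = CARD('n)" by (rule card_image)
    then show False using assms c(1) by simp
  qed
  then obtain i j where "i \<noteq> j" "c i = c j" by (auto simp: inj_def)
  then show thesis using that c(2) by blast
qed

lemma same_cyclic_class_sym: "same_cyclic_class A i j \<Longrightarrow> same_cyclic_class A j i"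
  by (auto simp: same_cyclic_class_def communicate_def)

section \<open>Boundary values of the process\<close>

context reinforced_process
begin

lemma Z_Suc_nth: "\<omega> \<in> space M \<Longrightarrow> Z (Suc n) \<omega> $ l = (1 - r n) * Z n \<omega> $ l + r n * X (Suc n) \<omega> $ l"
  by (simp add: Z_Suc)

text \<open>The old value keeps the positive weight \<open>1 - r n\<close>, so the boundary can be
  left but never reached from inside.\<close>

lemma Z_inner_Suc:
  assumes "\<omega> \<in> space M" "0 < Z n \<omega> $ l" "Z n \<omega> $ l < 1"
  shows "0 < Z (Suc n) \<omega> $ l" "Z (Suc n) \<omega> $ l < 1"
proof -
  have "0 < (1 - r n) * Z n \<omega> $ l" "(1 - r n) * Z n \<omega> $ l < 1 - r n"
    using assms r(2)[of n] by (simp_all add: mult_less_cancel_left2)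
  moreover have "0 \<le> r n * X (Suc n) \<omega> $ l" "r n * X (Suc n) \<omega> $ l \<le> r n"
    using X_range[OF assms(1), of n l] r[of n] by auto
  ultimately show "0 < Z (Suc n) \<omega> $ l" "Z (Suc n) \<omega> $ l < 1"
    unfolding Z_Suc_nth[OF assms(1)] by linarith+
qed

lemma Z_extreme_of_Suc:
  assumes \<omega>: "\<omega> \<in> space M"
  shows "Z (Suc n) \<omega> $ l = 0 \<Longrightarrow> Z n \<omega> $ l = 0" "Z (Suc n) \<omega> $ l = 1 \<Longrightarrow> Z n \<omega> $ l = 1"
proof -
  have z: "Z n \<omega> $ l = 0 \<or> Z n \<omega> $ l = 1 \<or> (0 < Z n \<omega> $ l \<and> Z n \<omega> $ l < 1)"
    using Z_range[OF \<omega>, of n l] by linarith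
  show "Z n \<omega> $ l = 0" if "Z (Suc n) \<omega> $ l = 0"
    using z Z_inner_Suc[OF \<omega>, of n l] X_range[OF \<omega>, of n l] r[of n] that \<omega>
    by (auto simp: Z_Suc_nth)
  show "Z n \<omega> $ l = 1" if "Z (Suc n) \<omega> $ l = 1"
    using z Z_inner_Suc[OF \<omega>, of n l] X_range[OF \<omega>, of n l] r[of n] that \<omega>
    by (auto simp: Z_Suc_nth)
qed

text \<open>Consensus at 0 or 1 can only have been there from the start; this is how the hypothesis
  on \<open>Z 0\<close> comes to bear on later times.\<close>

lemma Z0_extreme:
  assumes \<omega>: "\<omega> \<in> space M"
  shows "Z n \<omega> = 0 \<Longrightarrow> Z 0 \<omega> = 0" "Z n \<omega> = 1 \<Longrightarrow> Z 0 \<omega> = 1"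
  by (induction n) (auto simp: vec_eq_iff intro: Z_extreme_of_Suc[OF \<omega>])

text \<open>A weighted average of values in the unit interval is extreme only if every value with
  positive weight is.\<close>

lemma p_extreme:
  assumes \<omega>: "\<omega> \<in> space M" and pos: "P $ l $ m > 0"
  shows "p n l \<omega> = 0 \<Longrightarrow> Z n \<omega> $ m = 0" "p n l \<omega> = 1 \<Longrightarrow> Z n \<omega> $ m = 1"
proof -
  show "Z n \<omega> $ m = 0" if "p n l \<omega> = 0"
  proof -
    have "P $ l $ m * Z n \<omega> $ m = 0"
      using that unfolding p_eq using Z_range[OF \<omega>] nonneg by (subst (asm) sum_nonneg_eq_0_iff) auto
    then show ?thesis using pos by simp
  qed
  show "Z n \<omega> $ m = 1" if "p n l \<omega> = 1"
  proof -
    have "(\<Sum>m\<in>UNIV. P $ l $ m * (1 - Z n \<omega> $ m)) = 0"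
      using that row_sum'[of l] by (simp add: right_diff_distrib sum_subtractf p_eq)
    then have "P $ l $ m * (1 - Z n \<omega> $ m) = 0"
      using Z_range[OF \<omega>] nonneg by (subst (asm) sum_nonneg_eq_0_iff) auto
    then show ?thesis using pos by simp
  qed
qed

definition inside :: "nat \<Rightarrow> 'n set \<Rightarrow> 'a set" where
  "inside n S = {\<omega> \<in> space M. \<forall>l\<in>S. 0 < Z n \<omega> $ l \<and> Z n \<omega> $ l < 1}"

lemma inside_sets: "inside n S \<in> sets (F n)"
proof -
  have "{\<omega> \<in> space (F n). \<forall>l\<in>S. 0 < Z n \<omega> $ l \<and> Z n \<omega> $ l < 1} \<in> sets (F n)"
  proof (rule sets.sets_Collect_finite_All)
    fix l
    have [measurable]: "(\<lambda>\<omega>. Z n \<omega> $ l) \<in> borel_measurable (F n)" by (rule Z_F) simp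
    show "{\<omega> \<in> space (F n). 0 < Z n \<omega> $ l \<and> Z n \<omega> $ l < 1} \<in> sets (F n)" by measurable
  qed simp
  then show ?thesis by (simp add: inside_def)
qed

lemma F_events: "A \<in> sets (F n) \<Longrightarrow> A \<in> events"
  using subalgebra_F unfolding subalgebra_def by blast

lemma inside_Suc: "inside n S \<subseteq> inside (Suc n) S"
  by (auto simp: inside_def Z_inner_Suc)

text \<open>On \<open>B\<close>, \<open>p n l\<close> has the same integral as
  \<open>X (Suc n) \<omega> $ l\<close>, namely 0, and it is nonnegative.\<close>

lemma AE_eq_0_of_X_eq_0:
  assumes B: "B \<in> sets (F n)" and AE: "AE \<omega> in M. \<omega> \<in> B \<longrightarrow> X (Suc n) \<omega> $ l = 0"
  shows "AE \<omega> in M. \<omega> \<in> B \<longrightarrow> p n l \<omega> = 0"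
proof -
  note iB = bounded_measurable_indicator[OF B]
  have "(\<integral>\<omega>. indicator B \<omega> * p n l \<omega> \<partial>M) = (\<integral>\<omega>. indicator B \<omega> * X (Suc n) \<omega> $ l \<partial>M)"
    by (rule integral_X[OF iB, symmetric])
  also have "\<dots> = 0"
    by (rule integral_eq_zero_AE) (use AE in eventually_elim, auto)
  finally have "AE \<omega> in M. indicator B \<omega> * p n l \<omega> = (0::real)"
    by (subst (asm) integral_nonneg_eq_0_iff_AE)
       (auto intro!: integrable_M bounded_measurable_F_imp[OF iB] simp: p_range)
  then show ?thesis by eventually_elim auto
qed

lemma AE_eq_1_of_X_eq_1:
  assumes B: "B \<in> sets (F n)" and AE: "AE \<omega> in M. \<omega> \<in> B \<longrightarrow> X (Suc n) \<omega> $ l = 1"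
  shows "AE \<omega> in M. \<omega> \<in> B \<longrightarrow> p n l \<omega> = 1"
proof -
  note iB = bounded_measurable_indicator[OF B]
  note [simp] = integrable_M bounded_measurable_F_imp[OF iB]
  have "(\<integral>\<omega>. indicator B \<omega> * (1 - p n l \<omega>) \<partial>M) = (\<integral>\<omega>. indicator B \<omega> * (1 - X (Suc n) \<omega> $ l) \<partial>M)"
    by (simp add: right_diff_distrib integral_X[OF iB] F_events[OF B])
  also have "\<dots> = 0"
    by (rule integral_eq_zero_AE) (use AE in eventually_elim, auto)
  finally have "AE \<omega> in M. indicator B \<omega> * (1 - p n l \<omega>) = (0::real)"
    by (subst (asm) integral_nonneg_eq_0_iff_AE)
       (auto intro!: integrable_bounded_measurable bounded_measurable_M bounded_measurable_F_imp[OF iB] simp: p_range)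
  then show ?thesis by eventually_elim auto
qed

text \<open>
  A maximal set of indices which can simultaneously have values inside the unit interval is
  everything: outside such a set the process cannot move, so its conditional mean equals its value
  in \<open>{0, 1}\<close>, which propagates along the edges of \<open>P\<close> to all indices.
\<close>

lemma inside_UNIV_pos:
  assumes nontriv: "measure M {\<omega> \<in> space M. Z 0 \<omega> = 0} + measure M {\<omega> \<in> space M. Z 0 \<omega> = 1} < 1"
  obtains n where "0 < prob (inside n UNIV)"
proof -
  \<comment> \<open>The maximum is taken over sets and times together. The empty set at time 0 is
    admissible: its event is the whole space.\<close>
  have "\<exists>x. 0 < prob (inside (fst x) (snd x)) \<and>
      (\<forall>y. 0 < prob (inside (fst y) (snd y)) \<longrightarrow> card (snd y) \<le> card (snd x))"
  proof (rule ex_has_greatest_nat[where k = "(0, {})" and b = "Suc CARD('n)"])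
    show "0 < prob (inside (fst (0, {})) (snd (0, {})))" by (simp add: inside_def prob_space)
    show "\<forall>y :: nat \<times> 'n set. 0 < prob (inside (fst y) (snd y)) \<longrightarrow> card (snd y) < Suc CARD('n)"
      by (auto simp: less_Suc_eq_le intro: card_mono)
  qed
  then obtain n S where A: "0 < prob (inside n S)"
    and max: "\<And>m T. 0 < prob (inside m T) \<Longrightarrow> card T \<le> card S" by auto
  have null: "AE \<omega> in M. \<omega> \<notin> inside m (insert l S)" if "l \<notin> S" for m l
  proof -
    have "card (insert l S) = Suc (card S)" using that by (simp add: finite)
    then have "prob (inside m (insert l S)) = 0"
      using max[of m "insert l S"] by (metis Suc_n_not_le_n measure_le_0_iff not_less)
    then show ?thesis using prob_eq_0[OF F_events[OF inside_sets]] by blast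
  qed
  have "AE \<omega> in M. \<omega> \<in> inside n S \<longrightarrow> (Z n \<omega> $ l = 0 \<and> p n l \<omega> = 0 \<or> Z n \<omega> $ l = 1 \<and> p n l \<omega> = 1)"
    if l: "l \<notin> S" for l
  proof -
    \<comment> \<open>On \<open>inside n S\<close>, component \<open>l\<close> is at the boundary at
      times \<open>n\<close> and \<open>Suc n\<close>. With a step size strictly between 0 and 1
      this requires that \<open>X\<close> repeats its value.\<close>
    have ext: "AE \<omega> in M. \<omega> \<in> inside n S \<longrightarrow>
        (Z n \<omega> $ l = 0 \<or> Z n \<omega> $ l = 1) \<and> X (Suc n) \<omega> $ l = Z n \<omega> $ l"
      using null[OF l, of n] null[OF l, of "Suc n"] AE_space
    proof eventually_elim
      case (elim \<omega>)
      show ?case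
      proof
        assume \<omega>: "\<omega> \<in> inside n S"
        then have "\<omega> \<in> inside (Suc n) S" using inside_Suc by blast
        then have Z1: "\<not> (0 < Z (Suc n) \<omega> $ l \<and> Z (Suc n) \<omega> $ l < 1)"
          using elim by (auto simp: inside_def)
        have Z: "Z n \<omega> $ l = 0 \<or> Z n \<omega> $ l = 1"
          using elim \<omega> Z_range[of \<omega> n l] by (auto simp: inside_def)
        then show "(Z n \<omega> $ l = 0 \<or> Z n \<omega> $ l = 1) \<and> X (Suc n) \<omega> $ l = Z n \<omega> $ l"
          using X_range[of \<omega> n l] Z1 r[of n] elim by (auto simp: Z_Suc_nth)
      qed
    qed
    have [measurable]: "(\<lambda>\<omega>. Z n \<omega> $ l) \<in> borel_measurable (F n)" by (rule Z_F) simp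
    have B: "inside n S \<inter> {\<omega> \<in> space (F n). Z n \<omega> $ l = c} \<in> sets (F n)" for c
      using inside_sets by measurable
    have "AE \<omega> in M. \<omega> \<in> inside n S \<inter> {\<omega> \<in> space (F n). Z n \<omega> $ l = 0} \<longrightarrow> p n l \<omega> = 0"
      by (rule AE_eq_0_of_X_eq_0[OF B]) (use ext in eventually_elim, auto)
    moreover have "AE \<omega> in M. \<omega> \<in> inside n S \<inter> {\<omega> \<in> space (F n). Z n \<omega> $ l = 1} \<longrightarrow> p n l \<omega> = 1"
      by (rule AE_eq_1_of_X_eq_1[OF B]) (use ext in eventually_elim, auto)
    ultimately show ?thesis using ext AE_space by eventually_elim auto
  qed
  then have "AE \<omega> in M. \<forall>l\<in>-S. \<omega> \<in> inside n S \<longrightarrow>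
      (Z n \<omega> $ l = 0 \<and> p n l \<omega> = 0 \<or> Z n \<omega> $ l = 1 \<and> p n l \<omega> = 1)"
    by (intro AE_finite_allI) auto
  then have good: "AE \<omega> in M. \<omega> \<in> inside n S \<longrightarrow>
      (\<forall>l\<in>-S. Z n \<omega> $ l = 0 \<and> p n l \<omega> = 0 \<or> Z n \<omega> $ l = 1 \<and> p n l \<omega> = 1)"
    by eventually_elim blast
  have "S = UNIV"
  proof (rule ccontr)
    assume "S \<noteq> UNIV"
    then obtain l0 where l0: "l0 \<notin> S" by blast
    \<comment> \<open>A single outcome will do here, as the claim that follows concerns only the set
      \<open>S\<close>.\<close>
    have "\<not> (AE \<omega> in M. \<omega> \<notin> inside n S)"
      using A prob_eq_0[OF F_events[OF inside_sets], of n S] by linarith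
    moreover have "AE \<omega> in M. \<omega> \<notin> inside n S"
      if "\<not> (\<exists>\<omega>\<in>inside n S. \<forall>l\<in>-S. Z n \<omega> $ l = 0 \<and> p n l \<omega> = 0 \<or> Z n \<omega> $ l = 1 \<and> p n l \<omega> = 1)"
      using good by eventually_elim (use that in blast)
    ultimately obtain \<omega> where \<omega>: "\<omega> \<in> inside n S"
      "\<forall>l\<in>-S. Z n \<omega> $ l = 0 \<and> p n l \<omega> = 0 \<or> Z n \<omega> $ l = 1 \<and> p n l \<omega> = 1"
      by blast
    have "- S = UNIV"
    proof (rule forward_closed_eq_UNIV)
      show "l0 \<in> - S" using l0 by simp
      fix i j assume ij: "i \<in> - S" "P $ i $ j > 0"
      have "\<omega> \<in> space M" using \<omega>(1) by (simp add: inside_def)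
      then have "Z n \<omega> $ j = 0 \<or> Z n \<omega> $ j = 1"
        using bspec[OF \<omega>(2) ij(1)] p_extreme[OF _ ij(2)] by auto
      then show "j \<in> - S" using \<omega>(1) by (auto simp: inside_def)
    qed
    then have S: "S = {}" by auto
    have "AE \<omega> in M. \<omega> \<in> {\<omega> \<in> space M. Z 0 \<omega> = 0} \<union> {\<omega> \<in> space M. Z 0 \<omega> = 1}"
      using good AE_space
    proof eventually_elim
      case (elim \<omega>)
      then have g: "Z n \<omega> $ l = 0 \<and> p n l \<omega> = 0 \<or> Z n \<omega> $ l = 1 \<and> p n l \<omega> = 1" for l
        by (auto simp: S inside_def)
      \<comment> \<open>With \<open>S\<close> empty, every component is at the boundary, and along
        positive entries even the values agree. So there is consensus at 0 or 1.\<close>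
      have "{l. Z n \<omega> $ l = Z n \<omega> $ l0} = UNIV"
      proof (rule forward_closed_eq_UNIV)
        fix i j assume ij: "i \<in> {l. Z n \<omega> $ l = Z n \<omega> $ l0}" "P $ i $ j > 0"
        then show "j \<in> {l. Z n \<omega> $ l = Z n \<omega> $ l0}"
          using g[of i] p_extreme[OF elim(2) ij(2), of n] by auto
      qed simp
      then have "\<forall>l. Z n \<omega> $ l = Z n \<omega> $ l0" by blast
      then have "Z n \<omega> = 0 \<or> Z n \<omega> = 1" using g[of l0] by (auto simp: vec_eq_iff)
      then show ?case using Z0_extreme[OF elim(2)] elim(2) by blast
    qed
    moreover have ev: "{\<omega> \<in> space M. Z 0 \<omega> = c} \<in> events" for c
      using Z0_measurable by measurable
    ultimately have "prob ({\<omega> \<in> space M. Z 0 \<omega> = 0} \<union> {\<omega> \<in> space M. Z 0 \<omega> = 1}) = 1"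
      by (intro prob_eq_1[THEN iffD2]) auto
    moreover have "prob ({\<omega> \<in> space M. Z 0 \<omega> = 0} \<union> {\<omega> \<in> space M. Z 0 \<omega> = 1}) \<le>
        prob {\<omega> \<in> space M. Z 0 \<omega> = 0} + prob {\<omega> \<in> space M. Z 0 \<omega> = 1}"
      by (intro measure_Un_le ev)
    ultimately show False using nontriv by simp
  qed
  then show thesis using that A by blast
qed

text \<open>
  With positive probability the component \<open>l2\<close> is pushed up and the component \<open>l1\<close> is pushed down
  for so long that the remaining steps are too small to close the gap.
\<close>

lemma not_synchronized:
  assumes sum: "summable r" and "l1 \<noteq> l2"
    and E: "E \<in> sets (F n0)" "0 < prob E" "E \<subseteq> inside n0 UNIV"
    and le: "\<And>\<omega>. \<omega> \<in> E \<Longrightarrow> Z n0 \<omega> $ l1 \<le> Z n0 \<omega> $ l2"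
  shows "\<not> (AE \<omega> in M. (\<lambda>n. Z n \<omega> $ l2 - Z n \<omega> $ l1) \<longlonglongrightarrow> 0)"
proof
  assume conv: "AE \<omega> in M. (\<lambda>n. Z n \<omega> $ l2 - Z n \<omega> $ l1) \<longlonglongrightarrow> 0"
  define G where "G k = {\<omega> \<in> E. \<forall>j\<in>{n0..<k}. X (Suc j) \<omega> $ l2 = 1 \<and> X (Suc j) \<omega> $ l1 = 0}" for k
  define D where "D n \<omega> = Z n \<omega> $ l2 - Z n \<omega> $ l1" for n \<omega>
  have GE: "G k \<subseteq> E" for k by (auto simp: G_def)
  have EM: "E \<subseteq> space M" using E(3) by (auto simp: inside_def)
  have G_sets: "G k \<in> sets (F k)" if "n0 \<le> k" for k
    using that
  proof (induction k rule: dec_induct)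
    case base
    then show ?case using E(1) by (simp add: G_def)
  next
    case (step k)
    have [measurable]: "(\<lambda>\<omega>. X (Suc k) \<omega> $ l) \<in> borel_measurable (F (Suc k))" for l
      by (rule X_F) simp
    have [measurable]: "G k \<in> sets (F (Suc k))"
    proof -
      have "sets (F k) \<subseteq> sets (F (Suc k))"
        unfolding sets_F by (rule sigma_sets_mono') (fastforce simp: le_Suc_eq)
      then show ?thesis using step.IH by blast
    qed
    have "G (Suc k) = G k \<inter> {\<omega> \<in> space (F (Suc k)). X (Suc k) \<omega> $ l2 = 1 \<and> X (Suc k) \<omega> $ l1 = 0}"
      using step.hyps EM by (auto simp: G_def less_Suc_eq)
    also have "\<dots> \<in> sets (F (Suc k))" by measurable
    finally show ?case .
  qed
  have inside: "G k \<subseteq> inside k UNIV" if "n0 \<le> k" for k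
    using lift_Suc_mono_le[of "\<lambda>k. inside k UNIV", OF inside_Suc that] E(3) GE[of k] by blast
  have G_pos: "0 < prob (G k)" if "n0 \<le> k" for k
    using that
  proof (induction k rule: dec_induct)
    case base
    then show ?case using E(2) by (simp add: G_def)
  next
    case (step k)
    note iG = bounded_measurable_indicator[OF G_sets[OF step.hyps(1)]]
    note [simp] = integrable_M bounded_measurable_F_imp[OF iG]
    \<comment> \<open>\<open>X\<close> at \<open>l2\<close> times one minus \<open>X\<close> at
      \<open>l1\<close> indicates the next piece of the pattern. Conditional independence turns it
      into \<open>p k l2 \<omega> * (1 - p k l1 \<omega>)\<close>, which is positive while all
      components are inside.\<close>
    have "prob (G (Suc k)) = (\<integral>\<omega>. indicator (G (Suc k)) \<omega> \<partial>M)"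
      using F_events[OF G_sets[of "Suc k"]] step.hyps by simp
    also have "\<dots> = (\<integral>\<omega>. indicator (G k) \<omega> * X (Suc k) \<omega> $ l2
        - indicator (G k) \<omega> * (X (Suc k) \<omega> $ l2 * X (Suc k) \<omega> $ l1) \<partial>M)"
    proof (rule Bochner_Integration.integral_cong[OF refl])
      fix \<omega> assume "\<omega> \<in> space M"
      then show "indicator (G (Suc k)) \<omega> = indicator (G k) \<omega> * X (Suc k) \<omega> $ l2
        - indicator (G k) \<omega> * (X (Suc k) \<omega> $ l2 * X (Suc k) \<omega> $ l1)"
        using X_range[of \<omega> k l1] X_range[of \<omega> k l2] step.hyps
        by (auto simp: G_def less_Suc_eq indicator_def)
    qed
    also have "\<dots> = (\<integral>\<omega>. indicator (G k) \<omega> * p k l2 \<omega> - indicator (G k) \<omega> * (p k l2 \<omega> * p k l1 \<omega>) \<partial>M)"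
      using \<open>l1 \<noteq> l2\<close> by (simp add: integral_X[OF iG] integral_X_X[OF iG])
    also have "\<dots> = (\<integral>\<omega>. indicator (G k) \<omega> * (p k l2 \<omega> * (1 - p k l1 \<omega>)) \<partial>M)"
      by (rule Bochner_Integration.integral_cong[OF refl]) (simp add: algebra_simps)
    finally have eq: "prob (G (Suc k)) = \<dots>" .
    have "prob (G (Suc k)) \<noteq> 0"
    proof
      assume "prob (G (Suc k)) = 0"
      then have "AE \<omega> in M. indicator (G k) \<omega> * (p k l2 \<omega> * (1 - p k l1 \<omega>)) = (0::real)"
        unfolding eq by (subst (asm) integral_nonneg_eq_0_iff_AE) (auto simp: p_range)
      then have "AE \<omega> in M. \<omega> \<notin> G k"
        using AE_space
      proof eventually_elim
        case (elim \<omega>)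
        show ?case
        proof
          assume \<omega>: "\<omega> \<in> G k"
          then have in01: "0 < Z k \<omega> $ l" "Z k \<omega> $ l < 1" for l
            using inside[OF step.hyps(1)] by (auto simp: inside_def)
          have row: "\<exists>m. P $ l $ m > 0" for l
            using row_sum'[of l] nonneg by (metis less_le sum.neutral zero_neq_one)
          have "p k l \<omega> \<noteq> 0" "p k l \<omega> \<noteq> 1" for l
            using row[of l] p_extreme[OF elim(2), of l _ k] in01 by (metis less_irrefl)+
          then show False using elim \<omega> by simp
        qed
      qed
      then show False
        using step.IH prob_eq_0[OF F_events[OF G_sets[OF step.hyps(1)]]] by simp
    qed
    then show ?case by (simp add: less_le)
  qed
  have D_Suc: "D (Suc n) \<omega> = (1 - r n) * D n \<omega> + r n * (X (Suc n) \<omega> $ l2 - X (Suc n) \<omega> $ l1)"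
    if "\<omega> \<in> space M" for n \<omega>
    using that by (simp add: D_def Z_Suc_nth algebra_simps)
  have D_le: "D n \<omega> \<le> 1" if "\<omega> \<in> space M" for n \<omega>
    using Z_range[OF that, of n l1] Z_range[OF that, of n l2] by (simp add: D_def)
  \<comment> \<open>Starting from a nonnegative difference, the first step of the pattern produces
    at least \<open>r n0\<close>; further ones move the difference towards 1 and so do not reduce
    it.\<close>
  have D_ge: "r n0 \<le> D k \<omega>" if "Suc n0 \<le> k" "\<omega> \<in> G k" for k \<omega>
    using that
  proof (induction k rule: dec_induct)
    case base
    then have "\<omega> \<in> space M" "0 \<le> D n0 \<omega>" "X (Suc n0) \<omega> $ l2 = 1" "X (Suc n0) \<omega> $ l1 = 0"
      using EM le by (auto simp: G_def D_def)
    then show ?case using r[of n0] by (simp add: D_Suc)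
  next
    case (step k)
    then have *: "\<omega> \<in> space M" "X (Suc k) \<omega> $ l2 = 1" "X (Suc k) \<omega> $ l1 = 0" "\<omega> \<in> G k"
      using EM by (auto simp: G_def)
    have "0 \<le> r k * (1 - D k \<omega>)" using D_le[OF *(1)] r[of k] by simp
    then show ?case using * step.IH by (simp add: D_Suc algebra_simps)
  qed
  \<comment> \<open>Whatever \<open>X\<close> does, the old difference loses at most
    \<open>r n\<close> by shrinking, and the new draw subtracts at most \<open>r n\<close>
    more.\<close>
  have D_step: "D n \<omega> - 2 * r n \<le> D (Suc n) \<omega>" if "\<omega> \<in> space M" for n \<omega>
  proof -
    have "r n * D n \<omega> \<le> r n * 1" using D_le[OF that] r[of n] by (intro mult_left_mono) auto
    moreover have "- 1 \<le> X (Suc n) \<omega> $ l2 - X (Suc n) \<omega> $ l1"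
      using X_range[OF that, of n l1] X_range[OF that, of n l2] by auto
    then have "r n * (- 1) \<le> r n * (X (Suc n) \<omega> $ l2 - X (Suc n) \<omega> $ l1)"
      using r[of n] by (intro mult_left_mono) auto
    ultimately show ?thesis using that by (simp add: D_Suc algebra_simps)
  qed
  have D_tail: "D k \<omega> - 2 * (\<Sum>j=k..<m. r j) \<le> D m \<omega>" if "\<omega> \<in> space M" "k \<le> m" for k m \<omega>
    using that(2)
  proof (induction m rule: dec_induct)
    case (step m)
    then show ?case using D_step[OF that(1), of m] by simp
  qed simp
  \<comment> \<open>Steps beyond \<open>N\<close> cost at most twice \<open>r n0 / 4\<close>, so
    half of the gap \<open>r n0\<close> survives.\<close>
  obtain N where N: "\<And>k m. k \<ge> N \<Longrightarrow> norm (\<Sum>j=k..<m. r j) < r n0 / 4"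
    using sum r(1)[of n0] unfolding summable_Cauchy by (metis zero_less_divide_iff zero_less_numeral)
  \<comment> \<open>\<open>Suc n0\<close> ensures that the pattern has run for at least one
    step.\<close>
  define k where "k = max N (Suc n0)"
  have "AE \<omega> in M. \<omega> \<notin> G k"
    using conv
  proof eventually_elim
    case (elim \<omega>)
    show ?case
    proof
      assume \<omega>: "\<omega> \<in> G k"
      then have \<omega>M: "\<omega> \<in> space M" using GE EM by blast
      have "r n0 / 2 \<le> D m \<omega>" if "k \<le> m" for m
        using D_tail[OF \<omega>M that] D_ge[OF _ \<omega>] N[of k m] by (simp add: k_def)
      then have "r n0 / 2 \<le> 0"
        using elim unfolding D_def by (intro LIMSEQ_le_const[OF elim]) blast
      then show False using r(1)[of n0] by simp
    qed
  qed
  moreover have "n0 \<le> k" by (simp add: k_def)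
  ultimately show False
    using G_pos[of k] prob_eq_0[OF F_events[OF G_sets[of k]]] by linarith
qed

text \<open>Which component to push up depends on their order at time \<open>n\<close>, and one of
  the two orders has positive probability. Symmetry of the class relation refutes either
  alternative.\<close>

theorem no_synchronization:
  assumes sum: "summable r"
    and nontriv: "measure M {\<omega> \<in> space M. Z 0 \<omega> = 0} + measure M {\<omega> \<in> space M. Z 0 \<omega> = 1} < 1"
    and "l1 \<noteq> l2"
  shows "\<not> (AE \<omega> in M. (\<lambda>n. Z n \<omega> $ l2 - Z n \<omega> $ l1) \<longlonglongrightarrow> 0)
    \<or> \<not> (AE \<omega> in M. (\<lambda>n. Z n \<omega> $ l1 - Z n \<omega> $ l2) \<longlonglongrightarrow> 0)"
proof -
  obtain n where n: "0 < prob (inside n UNIV)" using inside_UNIV_pos[OF nontriv] .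
  define E where "E i j = inside n UNIV \<inter> {\<omega> \<in> space (F n). Z n \<omega> $ i \<le> Z n \<omega> $ j}" for i j
  have [measurable]: "(\<lambda>\<omega>. Z n \<omega> $ l) \<in> borel_measurable (F n)" for l by (rule Z_F) simp
  have E: "E i j \<in> sets (F n)" for i j
    unfolding E_def using inside_sets by measurable
  have "inside n UNIV = E l1 l2 \<union> E l2 l1"
    by (auto simp: E_def inside_def)
  then have "prob (inside n UNIV) \<le> prob (E l1 l2) + prob (E l2 l1)"
    using measure_Un_le[OF F_events[OF E] F_events[OF E]] by metis
  then consider "0 < prob (E l1 l2)" | "0 < prob (E l2 l1)"
    using n by linarith
  then show ?thesis
  proof cases
    case 1
    have "\<not> (AE \<omega> in M. (\<lambda>n. Z n \<omega> $ l2 - Z n \<omega> $ l1) \<longlonglongrightarrow> 0)"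
      by (rule not_synchronized[OF sum \<open>l1 \<noteq> l2\<close> E 1]) (auto simp: E_def)
    then show ?thesis ..
  next
    case 2
    have "\<not> (AE \<omega> in M. (\<lambda>n. Z n \<omega> $ l1 - Z n \<omega> $ l2) \<longlonglongrightarrow> 0)"
      by (rule not_synchronized[OF sum \<open>l1 \<noteq> l2\<close>[symmetric] E 2]) (auto simp: E_def)
    then show ?thesis ..
  qed
qed

end

section \<open>The equivalence of synchronization and divergence of the step sizes\<close>

theorem corollary2p3:
  fixes W :: "real ^ 'n ^ 'n"
    and r :: "nat \<Rightarrow> real"
    and M :: "'a measure"
    and Z X :: "nat \<Rightarrow> 'a \<Rightarrow> real ^ 'n"
  assumes N: "CARD('n) \<ge> 2"
    and W_nonneg: "\<forall>l1 l2. W $ l1 $ l2 \<ge> 0"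
    and W_irreducible: "irreducible_matrix W"
    and W_stochastic: "transpose W *v 1 = 1"
    and r: "\<forall>n. 0 < r n \<and> r n < 1"
    and M: "prob_space M"
    and Z0_measurable: "Z 0 \<in> borel_measurable M"
    and Z0_range: "\<forall>\<omega>\<in>space M. \<forall>l. Z 0 \<omega> $ l \<in> {0..1}"
    and Z0_nontrivial:
      "measure M {\<omega> \<in> space M. Z 0 \<omega> = 0} + measure M {\<omega> \<in> space M. Z 0 \<omega> = 1} < 1"
    and X_range: "\<forall>n. \<forall>\<omega>\<in>space M. \<forall>l. X (Suc n) \<omega> $ l \<in> {0, 1}"
    and X_cond_indep: "\<forall>n. cond_indep_vars M (hist M (Z 0) X n)
      (\<lambda>_. borel) (\<lambda>l \<omega>. X (Suc n) \<omega> $ l) UNIV"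
    and X_cond_prob: "\<forall>n l. AE \<omega> in M.
      real_cond_exp M (hist M (Z 0) X n) (indicator {\<omega> \<in> space M. X (Suc n) \<omega> $ l = 1}) \<omega>
        = (transpose W *v Z n \<omega>) $ l"
    and Z_Suc: "\<forall>n. \<forall>\<omega>\<in>space M.
      Z (Suc n) \<omega> = (1 - r n) *\<^sub>R Z n \<omega> + r n *\<^sub>R X (Suc n) \<omega>"
    and period: "matrix_period (transpose W) \<noteq> CARD('n)"
  shows "(\<forall>l1 l2. same_cyclic_class (transpose W) l1 l2 \<longrightarrow>
            (AE \<omega> in M. (\<lambda>n. Z n \<omega> $ l2 - Z n \<omega> $ l1) \<longlonglongrightarrow> 0))
         \<longleftrightarrow> filterlim (\<lambda>n. \<Sum>k<n. r k) at_top sequentially"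
proof -
  let ?P = "transpose W"
  interpret prob_space M by (rule M)
  interpret reinforced_process ?P M r Z X
  proof
    show "\<forall>i j. 0 \<le> ?P $ i $ j" using W_nonneg by (simp add: transpose_def)
    show "?P *v 1 = 1" by (rule W_stochastic)
    show "irreducible_matrix ?P" using W_irreducible by (rule irreducible_matrix_transpose)
  qed (use r Z0_measurable Z0_range X_range X_cond_indep X_cond_prob Z_Suc in auto)
  obtain i j where ij: "i \<noteq> j" "same_cyclic_class ?P i j"
    using same_cyclic_class_distinct[OF period] .
  have summable_iff: "filterlim (\<lambda>n. \<Sum>k<n. r k) at_top sequentially \<longleftrightarrow> \<not> summable r"
    using r by (intro filterlim_sum_at_top_iff) (simp add: less_imp_le)
  show ?thesis
    unfolding summable_iff
  proof (intro iffI allI impI)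
    assume sync: "\<forall>l1 l2. same_cyclic_class ?P l1 l2 \<longrightarrow>
      (AE \<omega> in M. (\<lambda>n. Z n \<omega> $ l2 - Z n \<omega> $ l1) \<longlonglongrightarrow> 0)"
    show "\<not> summable r"
      using no_synchronization[OF _ Z0_nontrivial ij(1)] sync ij(2) same_cyclic_class_sym[OF ij(2)] by blast
  qed (rule synchronization)
qed

end
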